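(* Let $Z$ be a smooth real manifold, and let $w$ and $w'$ be regular Poisson structures (Poisson bivector fields of constant rank) on $Z$ of the same rank $k\le \dim Z/2$, with associated bundle homomorphisms $w^\sharp, w'^\sharp : T^*Z\to TZ$ over $Z$. Then there exists a recursion operator between $w$ and $w'$, i.e. a smooth tangent-valued one-form (type $(1,1)$ tensor field) $R$ on $Z$ such that $$w'^\sharp = R\circ w^\sharp = w^\sharp\circ R^*,$$ if and only if the characteristic distributions of $w$ and $w'$ coincide, i.e. $w^\sharp(T^*Z)=w'^\sharp(T^*Z)$ as subbundles of $TZ$.
   Context: A Poisson bivector on $Z$ is a smooth bivector field whose Schouten–Nijenhuis bracket with itself vanishes. A bivector field $w$ defines the bundle homomorphism $w^\sharp: T^*Z\to TZ$ over $Z$ by $w^\sharp(\alpha) = -w(z)\lfloor\alpha$ (contraction of $w(z)$ with $\alpha$) for $\alpha\in T_z^*Z$; similarly for $w'$. A Poisson structure is regular if its bivector has constant rank; rank $k\le\dim Z/2$ means that the linear maps $w^\sharp_z: T_z^*Z\to T_zZ$ have rank $2k$ for all $z\in Z$. The characteristic distribution of a regular Poisson structure $w$ is the subbundle $w^\sharp(T^*Z)\subset TZ$, the image of $w^\sharp$. A type $(1,1)$ tensor field $R$ on $Z$ yields a bundle endomorphism $R: TZ\to TZ$ over $Z$ and the dual (transpose) bundle endomorphism $R^*: T^*Z\to T^*Z$. Here, a recursion operator between $w$ and $w'$ means precisely a type $(1,1)$ tensor field $R$ satisfying $w'^\sharp = R\circ w^\sharp = w^\sharp\circ R^*$; no condition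 on the Nijenhuis torsion of $R$ is part of this definition. *)

theory Defs
  imports "HOL-Analysis.Analysis" "HOL-Library.Function_Algebras"
begin

instantiation "fun" :: (type, real_vector) real_vector
begin

definition scaleR_fun :: "real \<Rightarrow> ('a \<Rightarrow> 'b) \<Rightarrow> 'a \<Rightarrow> 'b"
  where "scaleR_fun r f = (\<lambda>x. r *\<^sub>R f x)"

instance
  by standard (auto simp: scaleR_fun_def fun_eq_iff scaleR_add_right scaleR_add_left)

end

lemma scaleR_fun_apply [simp]: "(r *\<^sub>R f) x = r *\<^sub>R f x"
  by (simp add: scaleR_fun_def)

text \<open>Linearity of a map that is only relevant on a subspace \<open>S\<close> of its domain type.\<close>

definition linear_on :: "'v::real_vector set \<Rightarrow> ('v \<Rightarrow> 'u::real_vector) \<Rightarrow> bool"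
  where "linear_on S f \<longleftrightarrow>
    (\<forall>u\<in>S. \<forall>v\<in>S. f (u + v) = f u + f v) \<and> (\<forall>r. \<forall>v\<in>S. f (r *\<^sub>R v) = r *\<^sub>R f v)"

primrec Ck_on :: "nat \<Rightarrow> 'e::real_normed_vector set \<Rightarrow> ('e \<Rightarrow> 'f::real_normed_vector) \<Rightarrow> bool"
  where
    "Ck_on 0 S f \<longleftrightarrow> continuous_on S f"
  | "Ck_on (Suc n) S f \<longleftrightarrow>
       (\<forall>x\<in>S. f differentiable (at x)) \<and>
       (\<forall>v. Ck_on n S (\<lambda>x. frechet_derivative f (at x) v))"

text \<open>Only used for open \<open>S\<close> in a Euclidean space, where it is the usual notion of
  a \<open>C\<close>-infinity map.\<close>

definition smooth_on :: "'e::real_normed_vector set \<Rightarrow> ('e \<Rightarrow> 'f::real_normed_vector) \<Rightarrow> bool"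
  where "smooth_on S f \<longleftrightarrow> (\<forall>n. Ck_on n S f)"

text \<open>A chart is a pair of its domain and its coordinate map; the values of the coordinate map
  outside the domain carry no meaning.\<close>

type_synonym ('a, 'e) chart = "'a set \<times> ('a \<Rightarrow> 'e)"

abbreviation chart_dom :: "('a, 'e) chart \<Rightarrow> 'a set"
  where "chart_dom c \<equiv> fst c"

abbreviation chart_map :: "('a, 'e) chart \<Rightarrow> 'a \<Rightarrow> 'e"
  where "chart_map c \<equiv> snd c"

abbreviation chart_image :: "('a, 'e) chart \<Rightarrow> 'e set"
  where "chart_image c \<equiv> chart_map c ` chart_dom c"

abbreviation chart_inv :: "('a, 'e) chart \<Rightarrow> 'e \<Rightarrow> 'a"
  where "chart_inv c \<equiv> inv_into (chart_dom c) (chart_map c)"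

definition is_chart :: "'a topology \<Rightarrow> ('a, 'e::euclidean_space) chart \<Rightarrow> bool"
  where "is_chart Z c \<longleftrightarrow>
    openin Z (chart_dom c) \<and> open (chart_image c) \<and>
    homeomorphic_map (subtopology Z (chart_dom c)) (top_of_set (chart_image c)) (chart_map c)"

definition transition :: "('a, 'e) chart \<Rightarrow> ('a, 'e) chart \<Rightarrow> 'e \<Rightarrow> 'e"
  where "transition c d = chart_map d \<circ> chart_inv c"

text \<open>The smooth structure is given by an arbitrary (not necessarily maximal) smooth atlas \<open>A\<close>.
  The dimension of the manifold is that of the model space \<open>'e\<close>.\<close>

definition smooth_manifold :: "'a topology \<Rightarrow> ('a, 'e::euclidean_space) chart set \<Rightarrow> bool"
  where "smooth_manifold Z A \<longleftrightarrow>
    Hausdorff_space Z \<and> second_countable Z \<and>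
    (\<forall>c\<in>A. is_chart Z c) \<and> (\<Union>c\<in>A. chart_dom c) = topspace Z \<and>
    (\<forall>c\<in>A. \<forall>d\<in>A. smooth_on (chart_map c ` (chart_dom c \<inter> chart_dom d)) (transition c d))"

definition charts_at :: "('a, 'e) chart set \<Rightarrow> 'a \<Rightarrow> ('a, 'e) chart set"
  where "charts_at A p = {c \<in> A. p \<in> chart_dom c}"

text \<open>A tangent vector at \<open>p\<close> assigns to each chart around \<open>p\<close> its component vector in that chart,
  such that the components in different charts are related by the derivative of the transition map.
  It is \<open>0\<close> at all other arguments, so that equality of tangent vectors is equality of functions and
  \<open>tangent_space A p\<close> is a linear subspace of a function space, isomorphic to \<open>'e\<close>.\<close>

type_synonym ('a, 'e) tangent = "('a, 'e) chart \<Rightarrow> 'e"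
type_synonym ('a, 'e) cotangent = "('a, 'e) tangent \<Rightarrow> real"

definition tangent_space :: "('a, 'e::euclidean_space) chart set \<Rightarrow> 'a \<Rightarrow> ('a, 'e) tangent set"
  where "tangent_space A p = {v.
    (\<forall>c. c \<notin> charts_at A p \<longrightarrow> v c = 0) \<and>
    (\<forall>c\<in>charts_at A p. \<forall>d\<in>charts_at A p.
       v d = frechet_derivative (transition c d) (at (chart_map c p)) (v c))}"

text \<open>Covectors vanish outside the tangent space, so that their equality is equality of functions.\<close>

definition cotangent_space :: "('a, 'e::euclidean_space) chart set \<Rightarrow> 'a \<Rightarrow> ('a, 'e) cotangent set"
  where "cotangent_space A p = {\<alpha>.
    linear_on (tangent_space A p) \<alpha> \<and> (\<forall>v. v \<notin> tangent_space A p \<longrightarrow> \<alpha> v = 0)}"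

definition cotangent_bundle ::
    "'a topology \<Rightarrow> ('a, 'e::euclidean_space) chart set \<Rightarrow> ('a \<times> ('a, 'e) cotangent) set"
  where "cotangent_bundle Z A = (SIGMA p:topspace Z. cotangent_space A p)"

text \<open>For a chart \<open>c\<close> around \<open>p\<close> and a basis vector \<open>i\<close>, the coordinate vector
  (partial derivative along \<open>i\<close>) and the coordinate covector (differential of the \<open>i\<close>-th
  coordinate) at \<open>p\<close>.\<close>

definition coord_vec ::
    "('a, 'e::euclidean_space) chart set \<Rightarrow> ('a, 'e) chart \<Rightarrow> 'e \<Rightarrow> 'a \<Rightarrow> ('a, 'e) tangent"
  where "coord_vec A c i p = (\<lambda>d. if d \<in> charts_at A p
    then frechet_derivative (transition c d) (at (chart_map c p)) i else 0)"

definition coord_covec ::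
    "('a, 'e::euclidean_space) chart set \<Rightarrow> ('a, 'e) chart \<Rightarrow> 'e \<Rightarrow> 'a \<Rightarrow> ('a, 'e) cotangent"
  where "coord_covec A c i p = (\<lambda>v. if v \<in> tangent_space A p then v c \<bullet> i else 0)"

text \<open>A type (1,1) tensor field is a smooth family of endomorphisms \<open>R p\<close> of the tangent spaces.
  The values of \<open>R p\<close> off the tangent space at \<open>p\<close> carry no meaning.\<close>

definition tensor11_field ::
    "'a topology \<Rightarrow> ('a, 'e::euclidean_space) chart set
      \<Rightarrow> ('a \<Rightarrow> ('a, 'e) tangent \<Rightarrow> ('a, 'e) tangent) \<Rightarrow> bool"
  where "tensor11_field Z A R \<longleftrightarrow>
    (\<forall>p\<in>topspace Z. R p ` tangent_space A p \<subseteq> tangent_space A p \<and>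
       linear_on (tangent_space A p) (R p)) \<and>
    (\<forall>c\<in>A. \<forall>i\<in>Basis. \<forall>j\<in>Basis. smooth_on (chart_image c)
       (\<lambda>x. R (chart_inv c x) (coord_vec A c i (chart_inv c x)) c \<bullet> j))"

definition dual_endo ::
    "('a, 'e::euclidean_space) chart set \<Rightarrow> ('a \<Rightarrow> ('a, 'e) tangent \<Rightarrow> ('a, 'e) tangent)
      \<Rightarrow> 'a \<Rightarrow> ('a, 'e) cotangent \<Rightarrow> ('a, 'e) cotangent"
  where "dual_endo A R p \<alpha> = (\<lambda>v. if v \<in> tangent_space A p then \<alpha> (R p v) else 0)"

text \<open>A bivector at \<open>p\<close> is an alternating bilinear form on the cotangent space at \<open>p\<close>.\<close>

type_synonym ('a, 'e) bivector = "('a, 'e) cotangent \<Rightarrow> ('a, 'e) cotangent \<Rightarrow> real"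

definition bivec_comp ::
    "('a, 'e::euclidean_space) chart set \<Rightarrow> ('a, 'e) chart \<Rightarrow> ('a \<Rightarrow> ('a, 'e) bivector)
      \<Rightarrow> 'e \<Rightarrow> 'e \<Rightarrow> 'e \<Rightarrow> real"
  where "bivec_comp A c w i j x =
    w (chart_inv c x) (coord_covec A c i (chart_inv c x)) (coord_covec A c j (chart_inv c x))"

definition bivector_field ::
    "'a topology \<Rightarrow> ('a, 'e::euclidean_space) chart set \<Rightarrow> ('a \<Rightarrow> ('a, 'e) bivector) \<Rightarrow> bool"
  where "bivector_field Z A w \<longleftrightarrow>
    (\<forall>p\<in>topspace Z.
       (\<forall>\<alpha>\<in>cotangent_space A p.
          linear_on (cotangent_space A p) (\<lambda>\<beta>. w p \<alpha> \<beta>) \<and>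
          linear_on (cotangent_space A p) (\<lambda>\<beta>. w p \<beta> \<alpha>) \<and>
          w p \<alpha> \<alpha> = 0)) \<and>
    (\<forall>c\<in>A. \<forall>i\<in>Basis. \<forall>j\<in>Basis. smooth_on (chart_image c) (bivec_comp A c w i j))"

text \<open>Components, in the chart \<open>c\<close>, of the Schouten--Nijenhuis bracket of two bivector fields.
  Writing \<open>u = 1/2 \<Sum> u\<^sup>m\<^sup>i \<partial>\<^sub>m \<and> \<partial>\<^sub>i\<close>, the bracket is \<open>[u,w] = u \<bullet> w + w \<bullet> u\<close>, where
  \<open>u \<bullet> w = 1/2 \<Sum> u\<^sup>m\<^sup>i (\<partial>\<^sub>m w\<^sup>j\<^sup>k) \<partial>\<^sub>i \<and> \<partial>\<^sub>j \<and> \<partial>\<^sub>k\<close>.  Because \<open>w\<^sup>j\<^sup>k\<close> is skew in \<open>j, k\<close>,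
  evaluating the wedge product on three coordinate covectors gives the cyclic sum below.\<close>

definition schouten_term ::
    "('a, 'e::euclidean_space) chart set \<Rightarrow> ('a, 'e) chart \<Rightarrow> ('a \<Rightarrow> ('a, 'e) bivector)
      \<Rightarrow> ('a \<Rightarrow> ('a, 'e) bivector) \<Rightarrow> 'e \<Rightarrow> 'e \<Rightarrow> 'e \<Rightarrow> 'e \<Rightarrow> real"
  where "schouten_term A c u w i j k x =
    (\<Sum>m\<in>Basis. bivec_comp A c u m i x * frechet_derivative (bivec_comp A c w j k) (at x) m)"

definition schouten_dot ::
    "('a, 'e::euclidean_space) chart set \<Rightarrow> ('a, 'e) chart \<Rightarrow> ('a \<Rightarrow> ('a, 'e) bivector)
      \<Rightarrow> ('a \<Rightarrow> ('a, 'e) bivector) \<Rightarrow> 'e \<Rightarrow> 'e \<Rightarrow> 'e \<Rightarrow> 'e \<Rightarrow> real"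
  where "schouten_dot A c u w i j k x =
    schouten_term A c u w i j k x + schouten_term A c u w j k i x + schouten_term A c u w k i j x"

definition schouten_comp ::
    "('a, 'e::euclidean_space) chart set \<Rightarrow> ('a, 'e) chart \<Rightarrow> ('a \<Rightarrow> ('a, 'e) bivector)
      \<Rightarrow> ('a \<Rightarrow> ('a, 'e) bivector) \<Rightarrow> 'e \<Rightarrow> 'e \<Rightarrow> 'e \<Rightarrow> 'e \<Rightarrow> real"
  where "schouten_comp A c u w i j k x =
    schouten_dot A c u w i j k x + schouten_dot A c w u i j k x"

definition poisson_bivector ::
    "'a topology \<Rightarrow> ('a, 'e::euclidean_space) chart set \<Rightarrow> ('a \<Rightarrow> ('a, 'e) bivector) \<Rightarrow> bool"
  where "poisson_bivector Z A w \<longleftrightarrow>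
    bivector_field Z A w \<and>
    (\<forall>c\<in>A. \<forall>x\<in>chart_image c. \<forall>i\<in>Basis. \<forall>j\<in>Basis. \<forall>k\<in>Basis. schouten_comp A c w w i j k x = 0)"

text \<open>The contraction of \<open>w p\<close> with \<open>\<alpha>\<close> (in the last slot) is the tangent vector on which every
  covector \<open>\<beta>\<close> takes the value \<open>w p \<beta> \<alpha>\<close>.  Hence \<open>\<beta> (sharp A w p \<alpha>) = w p \<alpha> \<beta>\<close>, i.e. in
  coordinates \<open>\<alpha>\<^sub>i dx\<^sup>i\<close> is sent to \<open>w\<^sup>i\<^sup>j \<alpha>\<^sub>i \<partial>\<^sub>j\<close>.\<close>

definition contraction ::
    "('a, 'e::euclidean_space) chart set \<Rightarrow> ('a \<Rightarrow> ('a, 'e) bivector)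
      \<Rightarrow> 'a \<Rightarrow> ('a, 'e) cotangent \<Rightarrow> ('a, 'e) tangent"
  where "contraction A w p \<alpha> =
    (THE v. v \<in> tangent_space A p \<and> (\<forall>\<beta>\<in>cotangent_space A p. \<beta> v = w p \<beta> \<alpha>))"

definition sharp ::
    "('a, 'e::euclidean_space) chart set \<Rightarrow> ('a \<Rightarrow> ('a, 'e) bivector)
      \<Rightarrow> 'a \<Rightarrow> ('a, 'e) cotangent \<Rightarrow> ('a, 'e) tangent"
  where "sharp A w p \<alpha> = - contraction A w p \<alpha>"

text \<open>Convention: a Poisson structure of rank \<open>k\<close> has linear maps \<open>sharp A w p\<close> of rank \<open>2 * k\<close>.\<close>

definition regular_poisson ::
    "'a topology \<Rightarrow> ('a, 'e::euclidean_space) chart set \<Rightarrow> ('a \<Rightarrow> ('a, 'e) bivector) \<Rightarrow> nat \<Rightarrow> bool"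
  where "regular_poisson Z A w k \<longleftrightarrow>
    poisson_bivector Z A w \<and>
    (\<forall>p\<in>topspace Z. dim (sharp A w p ` cotangent_space A p) = 2 * k)"

definition characteristic_distribution ::
    "'a topology \<Rightarrow> ('a, 'e::euclidean_space) chart set \<Rightarrow> ('a \<Rightarrow> ('a, 'e) bivector)
      \<Rightarrow> ('a \<times> ('a, 'e) tangent) set"
  where "characteristic_distribution Z A w =
    (\<lambda>(p, \<alpha>). (p, sharp A w p \<alpha>)) ` cotangent_bundle Z A"

definition recursion_operator ::
    "'a topology \<Rightarrow> ('a, 'e::euclidean_space) chart set
      \<Rightarrow> ('a \<Rightarrow> ('a, 'e) bivector) \<Rightarrow> ('a \<Rightarrow> ('a, 'e) bivector)
      \<Rightarrow> ('a \<Rightarrow> ('a, 'e) tangent \<Rightarrow> ('a, 'e) tangent) \<Rightarrow> bool"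
  where "recursion_operator Z A w w' R \<longleftrightarrow>
    tensor11_field Z A R \<and>
    (\<forall>p\<in>topspace Z. \<forall>\<alpha>\<in>cotangent_space A p.
       sharp A w' p \<alpha> = R p (sharp A w p \<alpha>) \<and>
       sharp A w' p \<alpha> = sharp A w p (dual_endo A R p \<alpha>))"

end

theory Submission
  imports Defs "HOL-Computational_Algebra.Polynomial"
begin

text \<open>If \<open>w'\<^sup>\<sharp> = w\<^sup>\<sharp> \<circ> R\<^sup>*\<close> then the image of \<open>w'\<^sup>\<sharp>\<close> is contained in that of \<open>w\<^sup>\<sharp>\<close>, and the
  ranks agree.

  Conversely, let \<open>P\<close> and \<open>P'\<close> be the skew matrices of \<open>w\<close> and \<open>w'\<close> in a chart, and let \<open>\<pi>\<close> be the
  orthogonal projection onto the image of \<open>P a\<close>. Then \<open>G x = P x \<circ> \<pi> + (1 - \<pi>)\<close> is invertible at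
  \<open>x = a\<close>, hence has a smooth left inverse near \<open>a\<close>, and \<open>R x = P' x \<circ> \<pi> \<circ> (G x)\<^sup>-\<^sup>1\<close> satisfies
  \<open>R x \<circ> P x = P' x\<close>: by constancy of the rank \<open>P x \<circ> \<pi>\<close> has the same image as \<open>P x\<close>, and \<open>P x\<close> and
  \<open>P' x\<close> have the same kernel by skew-symmetry. The equation is affine in \<open>R\<close>, so the local solutions
  can be glued by a partition of unity.\<close>

section \<open>Smooth maps\<close>

text \<open>Openness of \<open>S\<close> makes \<open>f\<close> and \<open>g\<close> agree near each
  of its points, so their derivatives agree too and the induction can pass to the
  derivatives.\<close>

lemma Ck_on_cong:
  assumes "open S" "\<And>x. x \<in> S \<Longrightarrow> f x = g x"
  shows "Ck_on n S f \<longleftrightarrow> Ck_on n S g"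
  using assms(2)
proof (induction n arbitrary: f g)
  case 0
  then show ?case by (simp cong: continuous_on_cong)
next
  case (Suc n)
  have der: "(f has_derivative D) (at x) \<longleftrightarrow> (g has_derivative D) (at x)" if "x \<in> S" for x D
    using has_derivative_transform_within_open[OF _ assms(1) that] Suc.prems
    by metis
  \<comment> \<open>\<open>frechet_derivative\<close> chooses among all derivatives at the point, so
    equivalence of the \<open>has_derivative\<close> predicates gives equality even where none
    exists.\<close>
  have fr: "frechet_derivative f (at x) = frechet_derivative g (at x)" if "x \<in> S" for x
    using der[OF that] by (simp add: frechet_derivative_def)
  have "Ck_on n S (\<lambda>x. frechet_derivative f (at x) v) = Ck_on n S (\<lambda>x. frechet_derivative g (at x) v)" for v
    by (rule Suc.IH) (simp add: fr)
  then show ?case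
    using der by (auto simp: differentiable_def)
qed

text \<open>Admits an explicit derivative formula in place of the chosen
  \<open>frechet_derivative\<close>; the sum, product and chain rules below enter the inductions in
  this way.\<close>

lemma Ck_on_SucI:
  assumes "open S" "\<And>x. x \<in> S \<Longrightarrow> (f has_derivative f' x) (at x)"
    "\<And>v. Ck_on n S (\<lambda>x. f' x v)"
  shows "Ck_on (Suc n) S f"
proof -
  have "Ck_on n S (\<lambda>x. frechet_derivative f (at x) v)" for v
    using Ck_on_cong[OF assms(1), of "\<lambda>x. frechet_derivative f (at x) v" "\<lambda>x. f' x v"]
      assms(2,3) frechet_derivative_at by metis
  then show ?thesis using assms(2) by (auto simp: differentiable_def)
qed

lemma Ck_on_SucD:
  assumes "Ck_on (Suc n) S f"
  shows "x \<in> S \<Longrightarrow> (f has_derivative frechet_derivative f (at x)) (at x)"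
    "Ck_on n S (\<lambda>x. frechet_derivative f (at x) v)"
  using assms by (auto simp: frechet_derivative_works)

text \<open>The base case is that differentiability implies continuity; the rest is induction
  applied to the directional derivatives.\<close>

lemma Ck_on_Suc_imp: "Ck_on (Suc n) S f \<Longrightarrow> Ck_on n S f"
proof (induction n arbitrary: f)
  case 0
  then have "f differentiable (at x)" if "x \<in> S" for x
    using that by simp
  then have "continuous_on S f"
    by (intro continuous_at_imp_continuous_on ballI differentiable_imp_continuous_within)
  then show ?case by simp
next
  case (Suc n)
  have "Ck_on n S (\<lambda>x. frechet_derivative f (at x) v)" for v
    by (rule Suc.IH[OF Ck_on_SucD(2)[OF Suc.prems]])
  then show ?case using Suc.prems by simp
qed

lemma Ck_on_subset: "Ck_on n S f \<Longrightarrow> T \<subseteq> S \<Longrightarrow> Ck_on n T f"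
  by (induction n arbitrary: f) (auto intro: continuous_on_subset)

lemma Ck_on_local:
  assumes "\<And>x. x \<in> S \<Longrightarrow> \<exists>U. open U \<and> x \<in> U \<and> Ck_on n U f"
  shows "Ck_on n S f"
  using assms
proof (induction n arbitrary: f)
  case 0
  then have "continuous (at x) f" if "x \<in> S" for x
    using that continuous_on_eq_continuous_at by (metis Ck_on.simps(1))
  then show ?case by (simp add: continuous_at_imp_continuous_on)
next
  case (Suc n)
  have "f differentiable (at x)" if "x \<in> S" for x
    using Suc.prems[OF that] Ck_on.simps(2) by blast
  moreover have "Ck_on n S (\<lambda>x. frechet_derivative f (at x) v)" for v
  proof (rule Suc.IH)
    fix x assume "x \<in> S"
    then obtain U where "open U" "x \<in> U" "Ck_on (Suc n) U f"
      using Suc.prems by blast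
    then show "\<exists>U. open U \<and> x \<in> U \<and> Ck_on n U (\<lambda>x. frechet_derivative f (at x) v)"
      using Ck_on_SucD(2) by blast
  qed
  ultimately show ?case by simp
qed

lemma Ck_on_const: "Ck_on n S (\<lambda>x. c)"
  by (induction n arbitrary: c) (auto simp: frechet_derivative_const)

lemma Ck_on_bounded_linear:
  assumes "bounded_linear L" "open S"
  shows "Ck_on n S L"
proof (cases n)
  case 0
  then show ?thesis using assms by (simp add: linear_continuous_on)
next
  case (Suc m)
  show ?thesis unfolding Suc
    by (rule Ck_on_SucI[where f'="\<lambda>_. L"])
       (use assms in \<open>auto simp: Ck_on_const bounded_linear_imp_has_derivative\<close>)
qed

lemma Ck_on_add:
  assumes "open S" "Ck_on n S f" "Ck_on n S g"
  shows "Ck_on n S (\<lambda>x. f x + g x)"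
  using assms(2,3)
proof (induction n arbitrary: f g)
  case 0
  then show ?case by (simp add: continuous_on_add)
next
  case (Suc n)
  note 1 = Ck_on_SucD[OF Suc.prems(1)]
  note 2 = Ck_on_SucD[OF Suc.prems(2)]
  show ?case
    by (rule Ck_on_SucI[OF assms(1)], rule has_derivative_add[OF 1(1) 2(1)], assumption, assumption)
      (rule Suc.IH[OF 1(2) 2(2)])
qed

text \<open>Each term of the product rule is again \<open>B\<close> of two maps, one of them
  undifferentiated, so the induction hypothesis applies once \<open>Ck_on_Suc_imp\<close> has
  lowered the order of that factor.\<close>

lemma Ck_on_bounded_bilinear:
  assumes "bounded_bilinear B" "open S" "Ck_on n S f" "Ck_on n S g"
  shows "Ck_on n S (\<lambda>x. B (f x) (g x))"
  using assms(3,4)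
proof (induction n arbitrary: f g)
  case 0
  then show ?case by (simp add: bounded_bilinear.continuous_on[OF assms(1)])
next
  case (Suc n)
  note 1 = Ck_on_SucD[OF Suc.prems(1)] Ck_on_Suc_imp[OF Suc.prems(1)]
  note 2 = Ck_on_SucD[OF Suc.prems(2)] Ck_on_Suc_imp[OF Suc.prems(2)]
  let ?D = "\<lambda>x v. B (f x) (frechet_derivative g (at x) v) + B (frechet_derivative f (at x) v) (g x)"
  have "((\<lambda>x. B (f x) (g x)) has_derivative ?D x) (at x)" if "x \<in> S" for x
    by (rule bounded_bilinear.FDERIV[OF assms(1) 1(1)[OF that] 2(1)[OF that]])
  moreover have "Ck_on n S (\<lambda>x. ?D x v)" for v
    by (rule Ck_on_add[OF assms(2) Suc.IH[OF 1(3) 2(2)] Suc.IH[OF 1(2) 2(3)]])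
  ultimately show ?case
    by (rule Ck_on_SucI[OF assms(2)])
qed

lemma Ck_on_sum:
  assumes "open S" "\<And>i. i \<in> I \<Longrightarrow> Ck_on n S (f i)"
  shows "Ck_on n S (\<lambda>x. \<Sum>i\<in>I. f i x)"
  using assms(2)
proof (induction I rule: infinite_finite_induct)
  case (insert i I)
  then have "Ck_on n S (\<lambda>x. f i x + (\<Sum>i\<in>I. f i x))"
    by (intro Ck_on_add assms(1)) simp_all
  then show ?case using insert.hyps by simp
qed (simp_all add: Ck_on_const)

text \<open>\<open>Ck_on\<close> controls derivatives in fixed directions, whereas the chain rule
  evaluates them in a direction depending on \<open>x\<close>. Expanding \<open>v x\<close> in the
  finite basis bridges the two.\<close>

lemma Ck_on_linear_family:
  fixes v :: "'x::real_normed_vector \<Rightarrow> 'b::euclidean_space"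
    and L :: "'x \<Rightarrow> 'b \<Rightarrow> 'c::real_normed_vector"
  assumes "open S" "\<And>x. x \<in> S \<Longrightarrow> linear (L x)" "\<And>b. b \<in> Basis \<Longrightarrow> Ck_on n S (\<lambda>x. L x b)" "Ck_on n S v"
  shows "Ck_on n S (\<lambda>x. L x (v x))"
proof -
  have "L x (v x) = (\<Sum>b\<in>Basis. (v x \<bullet> b) *\<^sub>R L x b)" if "x \<in> S" for x
  proof -
    have "L x (v x) = L x (\<Sum>b\<in>Basis. (v x \<bullet> b) *\<^sub>R b)"
      by (simp add: euclidean_representation)
    also have "\<dots> = (\<Sum>b\<in>Basis. (v x \<bullet> b) *\<^sub>R L x b)"
      using assms(2)[OF that] by (simp add: linear_sum linear_scale)
    finally show ?thesis .
  qed
  moreover have "Ck_on n S (\<lambda>x. \<Sum>b\<in>Basis. (v x \<bullet> b) *\<^sub>R L x b)"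
    by (intro Ck_on_sum[OF assms(1)] Ck_on_bounded_bilinear[OF bounded_bilinear_scaleR assms(1)]
        Ck_on_bounded_bilinear[OF bounded_bilinear_inner assms(1)] assms(3,4) Ck_on_const)
  ultimately show ?thesis
    using Ck_on_cong[OF assms(1), of "\<lambda>x. L x (v x)" "\<lambda>x. \<Sum>b\<in>Basis. (v x \<bullet> b) *\<^sub>R L x b"]
    by blast
qed

text \<open>For each fixed direction the outer derivative composed with \<open>f\<close> is covered
  by the induction hypothesis; \<open>Ck_on_linear_family\<close> then inserts the moving direction
  from the chain rule.\<close>

lemma Ck_on_compose:
  fixes f :: "'x::real_normed_vector \<Rightarrow> 'b::euclidean_space"
  assumes "open S" "open T" "f ` S \<subseteq> T" "Ck_on n T g" "Ck_on n S f"
  shows "Ck_on n S (\<lambda>x. g (f x))"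
  using assms(4,5)
proof (induction n arbitrary: g)
  case 0
  then show ?case using assms(3) by (auto intro: continuous_on_compose2)
next
  case (Suc n)
  note 1 = Ck_on_SucD[OF Suc.prems(1)]
  note 2 = Ck_on_SucD[OF Suc.prems(2)] Ck_on_Suc_imp[OF Suc.prems(2)]
  have g: "(g has_derivative frechet_derivative g (at (f x))) (at (f x))" if "x \<in> S" for x
    using that assms(3) by (auto intro: 1)
  have "((\<lambda>x. g (f x)) has_derivative (\<lambda>v. frechet_derivative g (at (f x)) (frechet_derivative f (at x) v))) (at x)"
    if "x \<in> S" for x
    by (rule has_derivative_compose[OF 2(1)[OF that]]) (use g that in simp)
  moreover have "Ck_on n S (\<lambda>x. frechet_derivative g (at (f x)) (frechet_derivative f (at x) v))" for v
    by (rule Ck_on_linear_family[OF assms(1) has_derivative_linear[OF g] Suc.IH[OF 1(2) 2(3)] 2(2)])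
  ultimately show ?case
    by (rule Ck_on_SucI[OF assms(1)])
qed

text \<open>The derivative contains \<open>inverse (f x)\<close> again, but only to the lower order
  that the induction hypothesis supplies.\<close>

lemma Ck_on_inverse:
  fixes f :: "'x::real_normed_vector \<Rightarrow> real"
  assumes "open S" "\<And>x. x \<in> S \<Longrightarrow> f x \<noteq> 0" "Ck_on n S f"
  shows "Ck_on n S (\<lambda>x. inverse (f x))"
  using assms(3)
proof (induction n)
  case 0
  then show ?case using assms by (auto intro: continuous_on_inverse)
next
  case (Suc n)
  note 2 = Ck_on_SucD[OF Suc.prems] Ck_on_Suc_imp[OF Suc.prems]
  \<comment> \<open>Negation is written as a product with a constant, so that the product rule
    covers it too.\<close>
  let ?D = "\<lambda>x v. - 1 * (inverse (f x) * frechet_derivative f (at x) v * inverse (f x))"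
  have "((\<lambda>x. inverse (f x)) has_derivative ?D x) (at x)" if "x \<in> S" for x
    using Deriv.has_derivative_inverse[OF assms(2)[OF that] 2(1)[OF that]] by simp
  moreover have "Ck_on n S (\<lambda>x. ?D x v)" for v
    by (rule Ck_on_bounded_bilinear[OF bounded_bilinear_mult assms(1) Ck_on_const
        Ck_on_bounded_bilinear[OF bounded_bilinear_mult assms(1)
        Ck_on_bounded_bilinear[OF bounded_bilinear_mult assms(1) Suc.IH[OF 2(3)] 2(2)] Suc.IH[OF 2(3)]]])
  ultimately show ?case
    by (rule Ck_on_SucI[OF assms(1)])
qed

named_theorems smooth_intros

lemma smooth_on_cong:
  "open S \<Longrightarrow> (\<And>x. x \<in> S \<Longrightarrow> f x = g x) \<Longrightarrow> smooth_on S f \<longleftrightarrow> smooth_on S g"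
  using Ck_on_cong unfolding smooth_on_def by metis

lemma smooth_on_subset: "smooth_on S f \<Longrightarrow> T \<subseteq> S \<Longrightarrow> smooth_on T f"
  unfolding smooth_on_def using Ck_on_subset by blast

lemma smooth_on_local:
  assumes "\<And>x. x \<in> S \<Longrightarrow> \<exists>U. open U \<and> x \<in> U \<and> smooth_on U f"
  shows "smooth_on S f"
  using assms Ck_on_local unfolding smooth_on_def by meson

lemma smooth_on_const [smooth_intros]: "smooth_on S (\<lambda>x. c)"
  unfolding smooth_on_def using Ck_on_const by auto

lemma smooth_on_bounded_linear: "bounded_linear L \<Longrightarrow> open S \<Longrightarrow> smooth_on S L"
  unfolding smooth_on_def using Ck_on_bounded_linear by auto

lemma smooth_on_id [smooth_intros]: "open S \<Longrightarrow> smooth_on S (\<lambda>x. x)"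
  by (rule smooth_on_bounded_linear[OF bounded_linear_ident])

lemma smooth_on_add [smooth_intros]:
  "open S \<Longrightarrow> smooth_on S f \<Longrightarrow> smooth_on S g \<Longrightarrow> smooth_on S (\<lambda>x. f x + g x)"
  unfolding smooth_on_def using Ck_on_add by blast

lemma smooth_on_bounded_bilinear:
  "bounded_bilinear B \<Longrightarrow> open S \<Longrightarrow> smooth_on S f \<Longrightarrow> smooth_on S g \<Longrightarrow> smooth_on S (\<lambda>x. B (f x) (g x))"
  unfolding smooth_on_def using Ck_on_bounded_bilinear by blast

lemmas smooth_on_scaleR [smooth_intros] = smooth_on_bounded_bilinear[OF bounded_bilinear_scaleR]
lemmas smooth_on_inner [smooth_intros] = smooth_on_bounded_bilinear[OF bounded_bilinear_inner]
lemmas smooth_on_mult [smooth_intros] = smooth_on_bounded_bilinear[OF bounded_bilinear_mult]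

lemma smooth_on_diff [smooth_intros]:
  assumes "open S" "smooth_on S f" "smooth_on S g"
  shows "smooth_on S (\<lambda>x. f x - g x)"
proof -
  have "smooth_on S (\<lambda>x. f x + (-1) *\<^sub>R g x)"
    by (intro smooth_intros assms)
  then show ?thesis by simp
qed

lemma smooth_on_sum [smooth_intros]:
  "open S \<Longrightarrow> (\<And>i. i \<in> I \<Longrightarrow> smooth_on S (f i)) \<Longrightarrow> smooth_on S (\<lambda>x. \<Sum>i\<in>I. f i x)"
  by (simp add: smooth_on_def Ck_on_sum)

lemma smooth_on_prod [smooth_intros]:
  fixes f :: "'i \<Rightarrow> 'x::real_normed_vector \<Rightarrow> real"
  assumes "open S" "\<And>i. i \<in> I \<Longrightarrow> smooth_on S (f i)"
  shows "smooth_on S (\<lambda>x. \<Prod>i\<in>I. f i x)"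
  using assms(2)
proof (induction I rule: infinite_finite_induct)
  case (insert i I)
  then have "smooth_on S (\<lambda>x. f i x * (\<Prod>i\<in>I. f i x))"
    by (intro smooth_on_mult assms(1)) simp_all
  then show ?case using insert.hyps by simp
qed (simp_all add: smooth_on_const)

lemma smooth_on_linear_family:
  fixes v :: "'x::real_normed_vector \<Rightarrow> 'b::euclidean_space"
    and L :: "'x \<Rightarrow> 'b \<Rightarrow> 'c::real_normed_vector"
  shows "open S \<Longrightarrow> (\<And>x. x \<in> S \<Longrightarrow> linear (L x)) \<Longrightarrow> (\<And>b. b \<in> Basis \<Longrightarrow> smooth_on S (\<lambda>x. L x b)) \<Longrightarrow>
    smooth_on S v \<Longrightarrow> smooth_on S (\<lambda>x. L x (v x))"
  by (simp add: smooth_on_def Ck_on_linear_family)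

lemma smooth_on_compose:
  fixes f :: "'x::real_normed_vector \<Rightarrow> 'b::euclidean_space"
  assumes "smooth_on T g" "smooth_on S f" "open S" "open T" "f ` S \<subseteq> T"
  shows "smooth_on S (\<lambda>x. g (f x))"
  using assms by (simp add: smooth_on_def Ck_on_compose[of S T f])

lemma smooth_on_inverse [smooth_intros]:
  fixes f :: "'x::real_normed_vector \<Rightarrow> real"
  shows "open S \<Longrightarrow> smooth_on S f \<Longrightarrow> (\<And>x. x \<in> S \<Longrightarrow> f x \<noteq> 0) \<Longrightarrow> smooth_on S (\<lambda>x. inverse (f x))"
  by (simp add: smooth_on_def Ck_on_inverse)

lemma smooth_on_frechet_derivative:
  "smooth_on S f \<Longrightarrow> smooth_on S (\<lambda>x. frechet_derivative f (at x) v)"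
  using Ck_on_SucD(2) unfolding smooth_on_def by blast

lemma smooth_on_has_derivative:
  "smooth_on S f \<Longrightarrow> x \<in> S \<Longrightarrow> (f has_derivative frechet_derivative f (at x)) (at x)"
  using Ck_on_SucD(1) unfolding smooth_on_def by blast

lemma smooth_on_continuous_on: "smooth_on S f \<Longrightarrow> continuous_on S f"
  using Ck_on.simps(1) unfolding smooth_on_def by blast

section \<open>A bump function\<close>

text \<open>For \<open>p = 1\<close> this is the classical flat function \<open>exp (- 1/t)\<close>.
  The polynomial in \<open>1/t\<close> makes the family closed under differentiation.\<close>

definition flat_exp :: "real poly \<Rightarrow> real \<Rightarrow> real"
  where "flat_exp p t = (if t > 0 then poly p (inverse t) * exp (- inverse t) else 0)"

text \<open>The exponential outgrows every power. Substituting \<open>s = inverse t\<close> turns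
  this into the one-sided limit at 0 needed for \<open>flat_exp\<close>.\<close>

lemma poly_times_exp_tendsto_0:
  fixes p :: "real poly"
  shows "((\<lambda>s. poly p s * exp (- s)) \<longlongrightarrow> 0) at_top"
proof -
  have "((\<lambda>s. \<Sum>i\<le>degree p. coeff p i * (s ^ i / exp s)) \<longlongrightarrow> (\<Sum>i\<le>degree p. coeff p i * 0)) at_top"
    by (intro tendsto_intros tendsto_power_div_exp_0)
  then show ?thesis
    by (simp add: poly_altdef sum_distrib_right exp_minus divide_inverse mult.assoc)
qed

text \<open>For positive \<open>t\<close>, the derivative of \<open>1/t\<close> accounts for the
  factor \<open>monom 1 2\<close>, the exponential for \<open>p\<close> and the polynomial for
  \<open>- pderiv p\<close>. At 0 the difference quotient tends to 0 from both sides.\<close>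

lemma has_real_derivative_flat_exp:
  "(flat_exp p has_real_derivative flat_exp (monom 1 2 * (p - pderiv p)) t) (at t)"
proof -
  consider "t > 0" | "t < 0" | "t = 0" by linarith
  then show ?thesis
  proof cases
    case 1
    have "((\<lambda>t. poly p (inverse t) * exp (- inverse t)) has_real_derivative
        flat_exp (monom 1 2 * (p - pderiv p)) t) (at t)"
      using 1 by (auto intro!: derivative_eq_intros DERIV_chain2[OF poly_DERIV]
          simp: flat_exp_def poly_monom power2_eq_square algebra_simps)
    then show ?thesis
      by (rule has_field_derivative_transform_within_open[where S="{0<..}"])
        (use 1 in \<open>auto simp: flat_exp_def\<close>)
  next
    case 2
    have "((\<lambda>t. 0) has_real_derivative flat_exp (monom 1 2 * (p - pderiv p)) t) (at t)"
      using 2 by (simp add: flat_exp_def)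
    then show ?thesis
      by (rule has_field_derivative_transform_within_open[where S="{..<0}"])
        (use 2 in \<open>auto simp: flat_exp_def\<close>)
  next
    case 3
    \<comment> \<open>Dividing by \<open>t\<close> multiplies the polynomial in \<open>1/t\<close>
      by its variable, so the quotient has the form whose limit is known.\<close>
    have "((\<lambda>t. poly (monom 1 1 * p) (inverse t) * exp (- inverse t)) \<longlongrightarrow> 0) (at_right 0)"
      by (rule filterlim_compose[OF poly_times_exp_tendsto_0 filterlim_inverse_at_top_right])
    then have "((\<lambda>t. flat_exp p t / t) \<longlongrightarrow> 0) (at_right 0)"
      by (rule Lim_transform_eventually)
        (auto simp: eventually_at_filter flat_exp_def poly_monom field_simps)
    moreover have "((\<lambda>t. flat_exp p t / t) \<longlongrightarrow> 0) (at_left 0)"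
      by (rule Lim_transform_eventually[OF tendsto_const])
        (auto simp: eventually_at_filter flat_exp_def)
    ultimately have "((\<lambda>t. flat_exp p t / t) \<longlongrightarrow> 0) (at 0)"
      by (rule filterlim_split_at[rotated])
    then show ?thesis
      using 3 by (simp add: has_field_derivative_iff flat_exp_def)
  qed
qed

text \<open>The derivative of a member of the family is a member again, with another polynomial;
  hence the induction generalises over \<open>p\<close>.\<close>

lemma smooth_on_flat_exp: "smooth_on UNIV (flat_exp p)"
proof -
  have "Ck_on n UNIV (flat_exp p)" for n
  proof (induction n arbitrary: p)
    case 0
    show ?case
      by (simp add: continuous_at_imp_continuous_on DERIV_isCont[OF has_real_derivative_flat_exp])
  next
    case (Suc n)
    show ?case
      by (rule Ck_on_SucI[OF open_UNIV has_real_derivative_flat_exp[unfolded has_field_derivative_def]])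
        (rule Ck_on_bounded_bilinear[OF bounded_bilinear_mult open_UNIV Suc.IH Ck_on_const])
  qed
  then show ?thesis by (simp add: smooth_on_def)
qed

lemma smooth_bump_function:
  fixes a :: "'e::euclidean_space"
  assumes "r > 0"
  obtains f :: "'e \<Rightarrow> real" where "smooth_on UNIV f"
    "\<And>x. x \<in> ball a (r / 2) \<Longrightarrow> f x = 1" "\<And>x. x \<notin> ball a r \<Longrightarrow> f x = 0"
proof
  define h where "h = flat_exp 1"
  have h: "smooth_on UNIV h" unfolding h_def by (rule smooth_on_flat_exp)
  have h_nonneg: "h t \<ge> 0" and h_pos: "t > 0 \<Longrightarrow> h t > 0" and h_0: "t \<le> 0 \<Longrightarrow> h t = 0" for t
    by (auto simp: h_def flat_exp_def)
  \<comment> \<open>The squared distance, unlike the distance, is smooth at the centre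
    \<open>a\<close>.\<close>
  define q where "q = (\<lambda>x::'e. (x - a) \<bullet> (x - a))"
  \<comment> \<open>Since \<open>r^2 / 4 < r^2\<close>, at every point one summand of the
    denominator is positive. Inside radius \<open>r / 2\<close> the second summand vanishes, and
    outside radius \<open>r\<close> the numerator does.\<close>
  define f where "f = (\<lambda>x. h (r\<^sup>2 - q x) * inverse (h (r\<^sup>2 - q x) + h (q x - r\<^sup>2 / 4)))"
  have pos: "h (r\<^sup>2 - q x) + h (q x - r\<^sup>2 / 4) > 0" for x
  proof (cases "q x < r\<^sup>2")
    case True
    then show ?thesis by (intro add_pos_nonneg h_pos h_nonneg) simp
  next
    case False
    have "r\<^sup>2 > 0" using assms by simp
    then show ?thesis using False by (intro add_nonneg_pos h_pos h_nonneg) linarith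
  qed
  have q: "smooth_on UNIV q"
    unfolding q_def by (intro smooth_intros open_UNIV)
  show "smooth_on UNIV f"
    unfolding f_def
    by (intro smooth_on_mult smooth_on_inverse smooth_on_add smooth_on_compose[OF h] smooth_on_diff
        smooth_on_const q open_UNIV subset_UNIV) (use pos in \<open>metis less_irrefl\<close>)
  have q_eq: "q x = (dist a x)\<^sup>2" for x
    by (simp add: q_def dist_norm norm_minus_commute dot_square_norm)
  show "f x = 1" if "x \<in> ball a (r / 2)" for x
  proof -
    have "q x < (r / 2)\<^sup>2"
      unfolding q_eq using that by (intro power_strict_mono) auto
    then have "h (q x - r\<^sup>2 / 4) = 0" by (intro h_0) (simp add: power_divide)
    then show ?thesis using pos[of x] by (simp add: f_def)
  qed
  show "f x = 0" if "x \<notin> ball a r" for x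
  proof -
    have "r\<^sup>2 \<le> q x"
      unfolding q_eq using that assms by (intro power_mono) auto
    then show ?thesis by (simp add: f_def h_0)
  qed
qed

section \<open>Smooth families of linear maps\<close>

text \<open>Smoothness is tested on fixed arguments, which in finite dimension amounts to smooth
  matrix entries and avoids a norm on a space of linear maps.\<close>

definition smooth_linear_on ::
    "'x::real_normed_vector set \<Rightarrow> ('x \<Rightarrow> 'b::euclidean_space \<Rightarrow> 'c::real_normed_vector) \<Rightarrow> bool"
  where "smooth_linear_on S L \<longleftrightarrow> (\<forall>x\<in>S. linear (L x)) \<and> (\<forall>v. smooth_on S (\<lambda>x. L x v))"

lemma smooth_linear_onD:
  assumes "smooth_linear_on S L"
  shows "x \<in> S \<Longrightarrow> linear (L x)" "smooth_on S (\<lambda>x. L x v)"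
  using assms by (auto simp: smooth_linear_on_def)

lemma smooth_linear_on_apply:
  "smooth_linear_on S L \<Longrightarrow> open S \<Longrightarrow> smooth_on S v \<Longrightarrow> smooth_on S (\<lambda>x. L x (v x))"
  by (rule smooth_on_linear_family) (auto simp: smooth_linear_on_def)

lemma smooth_linear_on_subset: "smooth_linear_on S L \<Longrightarrow> T \<subseteq> S \<Longrightarrow> smooth_linear_on T L"
  by (auto simp: smooth_linear_on_def intro: smooth_on_subset)

lemma smooth_linear_on_const: "open S \<Longrightarrow> linear L \<Longrightarrow> smooth_linear_on S (\<lambda>x. L)"
  by (simp add: smooth_linear_on_def smooth_on_const)

lemma smooth_linear_on_compose:
  assumes "open S" "smooth_linear_on S L" "smooth_linear_on S M"
  shows "smooth_linear_on S (\<lambda>x v. L x (M x v))"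
  unfolding smooth_linear_on_def
proof (intro conjI ballI allI)
  show "linear (\<lambda>v. L x (M x v))" if "x \<in> S" for x
    using linear_compose[OF smooth_linear_onD(1)[OF assms(3) that] smooth_linear_onD(1)[OF assms(2) that]]
    by (simp add: o_def)
  show "smooth_on S (\<lambda>x. L x (M x v))" for v
    by (rule smooth_linear_on_apply[OF assms(2,1) smooth_linear_onD(2)[OF assms(3)]])
qed

text \<open>Columns are switched on one at a time; each step is a rank-one perturbation, whose inverse
  is given by the Sherman--Morrison formula.\<close>

lemma smooth_left_inverse_near_id:
  fixes u :: "'e::euclidean_space \<Rightarrow> 'e \<Rightarrow> 'e"
  assumes "open S" "a \<in> S" "\<And>b. smooth_on S (u b)" "\<And>b. u b a = 0" "finite F"
  shows "\<exists>U H. open U \<and> a \<in> U \<and> U \<subseteq> S \<and> smooth_linear_on U H \<and>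
    (\<forall>x\<in>U. \<forall>v. H x (v + (\<Sum>b\<in>F. (v \<bullet> b) *\<^sub>R u b x)) = v)"
  using assms(5)
proof (induction F)
  case empty
  show ?case
    using assms(1,2) smooth_linear_on_const[OF assms(1) linear_id, unfolded id_def]
    by (intro exI[of _ S] exI[of _ "\<lambda>x v. v"]) simp
next
  case (insert b F)
  then obtain U H where U: "open U" "a \<in> U" "U \<subseteq> S" and H: "smooth_linear_on U H"
    and inv: "\<And>x v. x \<in> U \<Longrightarrow> H x (v + (\<Sum>b\<in>F. (v \<bullet> b) *\<^sub>R u b x)) = v"
    by blast
  \<comment> \<open>\<open>y\<close> is the new column seen through the inverse built so far, and
    \<open>d\<close> is the denominator of the update formula. At \<open>a\<close> the column is 0,
    so \<open>d a = 1\<close> and \<open>V\<close> is a neighbourhood of \<open>a\<close>.\<close>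
  define y where "y = (\<lambda>x. H x (u b x))"
  define d where "d = (\<lambda>x. 1 + y x \<bullet> b)"
  define V where "V = {x\<in>U. d x \<noteq> 0}"
  define H' where "H' = (\<lambda>x v. H x v - ((H x v \<bullet> b) * inverse (d x)) *\<^sub>R y x)"
  have y: "smooth_on U y"
    unfolding y_def
    by (rule smooth_linear_on_apply[OF H U(1) smooth_on_subset[OF assms(3) U(3)]])
  have d: "smooth_on U d"
    unfolding d_def by (intro smooth_intros y U)
  have "open V"
    using continuous_open_preimage[OF smooth_on_continuous_on[OF d] U(1), of "- {0}"]
    by (simp add: V_def vimage_def Int_def open_Compl)
  moreover have "a \<in> V"
    using U(2) linear_0[OF smooth_linear_onD(1)[OF H]] by (simp add: V_def d_def y_def assms(4))
  moreover have "V \<subseteq> S" using U by (auto simp: V_def)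
  moreover have "smooth_linear_on V H'"
  proof -
    have "V \<subseteq> U" by (auto simp: V_def)
    have "linear (H' x)" if "x \<in> V" for x
    proof -
      have "linear (H x)" using that smooth_linear_onD(1)[OF H] by (auto simp: V_def)
      then show ?thesis
        unfolding H'_def
        by (intro linearI) (simp_all add: linear_add linear_scale algebra_simps)
    qed
    moreover have "smooth_on V (\<lambda>x. H' x v)" for v
      unfolding H'_def
      by (intro smooth_intros \<open>open V\<close> smooth_on_subset[OF smooth_linear_onD(2)[OF H] \<open>V \<subseteq> U\<close>]
          smooth_on_subset[OF d \<open>V \<subseteq> U\<close>] smooth_on_subset[OF y \<open>V \<subseteq> U\<close>]) (simp add: V_def)
    ultimately show ?thesis by (simp add: smooth_linear_on_def)
  qed
  moreover have "H' x (v + (\<Sum>b\<in>insert b F. (v \<bullet> b) *\<^sub>R u b x)) = v" if "x \<in> V" for x v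
  proof -
    have x: "x \<in> U" "d x \<noteq> 0" using that by (auto simp: V_def)
    have l: "linear (H x)" using smooth_linear_onD(1)[OF H x(1)] .
    have "v + (\<Sum>b\<in>insert b F. (v \<bullet> b) *\<^sub>R u b x) =
        (v + (\<Sum>b\<in>F. (v \<bullet> b) *\<^sub>R u b x)) + (v \<bullet> b) *\<^sub>R u b x"
      using insert.hyps by (simp add: add_ac)
    then have "H x (v + (\<Sum>b\<in>insert b F. (v \<bullet> b) *\<^sub>R u b x)) = v + (v \<bullet> b) *\<^sub>R y x"
      using l inv[OF x(1)] by (simp only: linear_add linear_scale y_def)
    \<comment> \<open>This \<open>b\<close>-component exceeds that of \<open>v\<close> by the factor
      \<open>d x\<close>, so dividing by \<open>d x\<close> yields exactly the multiple of
      \<open>y x\<close> to be subtracted.\<close>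
    moreover have "(v + (v \<bullet> b) *\<^sub>R y x) \<bullet> b = (v \<bullet> b) * d x"
      by (simp add: d_def algebra_simps)
    ultimately show ?thesis
      using x(2) by (simp add: H'_def)
  qed
  ultimately show ?case by blast
qed

text \<open>Composing with a left inverse \<open>L\<close> of \<open>G a\<close> reduces the claim
  to a family that is the identity at \<open>a\<close>.\<close>

lemma smooth_local_left_inverse:
  fixes G :: "'e::euclidean_space \<Rightarrow> 'e \<Rightarrow> 'e"
  assumes "open S" "a \<in> S" "smooth_linear_on S G" "inj (G a)"
  obtains U H where "open U" "a \<in> U" "U \<subseteq> S" "smooth_linear_on U H"
    "\<And>x v. x \<in> U \<Longrightarrow> H x (G x v) = v"
proof -
  obtain L where L: "linear L" "L \<circ> G a = id"
    using linear_injective_left_inverse[OF smooth_linear_onD(1)[OF assms(3,2)] assms(4)] by blast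
  \<comment> \<open>These are the columns of \<open>L \<circ> G x - id\<close>, which vanish at
    \<open>x = a\<close>.\<close>
  define u where "u = (\<lambda>b x. L (G x b) - b)"
  have "smooth_on S (u b)" for b
    unfolding u_def
    by (intro smooth_on_diff assms(1) smooth_on_const
        smooth_linear_on_apply[OF smooth_linear_on_const[OF assms(1) L(1)] assms(1)]
        smooth_linear_onD(2)[OF assms(3)])
  moreover have "u b a = 0" for b
    using L(2) by (simp add: u_def fun_eq_iff)
  ultimately obtain U H where U: "open U" "a \<in> U" "U \<subseteq> S" and H: "smooth_linear_on U H"
    and inv: "\<And>x v. x \<in> U \<Longrightarrow> H x (v + (\<Sum>b\<in>Basis. (v \<bullet> b) *\<^sub>R u b x)) = v"
    using smooth_left_inverse_near_id[OF assms(1,2) _ _ finite_Basis, of u] by blast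
  show thesis
  proof
    show "smooth_linear_on U (\<lambda>x v. H x (L v))"
      by (rule smooth_linear_on_compose[OF U(1) H smooth_linear_on_const[OF U(1) L(1)]])
    show "H x (L (G x v)) = v" if "x \<in> U" for x v
    proof -
      have G: "linear (G x)" using smooth_linear_onD(1)[OF assms(3)] U(3) that by blast
      have LG: "linear (\<lambda>v. L (G x v))"
        using linear_compose[OF G L(1)] by (simp add: o_def)
      have "L (G x v) = (\<Sum>b\<in>Basis. (v \<bullet> b) *\<^sub>R L (G x b))"
        using linear_sum[OF LG, of "\<lambda>b. (v \<bullet> b) *\<^sub>R b" Basis]
        by (simp add: euclidean_representation linear_scale[OF LG])
      then have "L (G x v) = v + (\<Sum>b\<in>Basis. (v \<bullet> b) *\<^sub>R u b x)"
        by (simp add: u_def scaleR_diff_right sum_subtractf euclidean_representation)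
      then show ?thesis using inv[OF that] by simp
    qed
  qed (use U in auto)
qed

text \<open>The local problem in coordinates, where \<open>P\<close> and \<open>P'\<close> become
  the matrices of the two sharp maps. Constant rank lets one fixed subspace, the image at
  \<open>a\<close>, serve all nearby \<open>x\<close>.\<close>

lemma local_recursion_operator:
  fixes P P' :: "'e::euclidean_space \<Rightarrow> 'e \<Rightarrow> 'e"
  assumes S: "open S" "a \<in> S"
    and P: "smooth_linear_on S P" and P': "smooth_linear_on S P'"
    and skew: "\<And>x u v. x \<in> S \<Longrightarrow> P x u \<bullet> v = - (P x v \<bullet> u)"
    and skew': "\<And>x u v. x \<in> S \<Longrightarrow> P' x u \<bullet> v = - (P' x v \<bullet> u)"
    and rank: "\<And>x. x \<in> S \<Longrightarrow> dim (range (P x)) = r"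
    and range: "\<And>x. x \<in> S \<Longrightarrow> range (P' x) = range (P x)"
  obtains U M where "open U" "a \<in> U" "U \<subseteq> S" "smooth_linear_on U M"
    "\<And>x u. x \<in> U \<Longrightarrow> M x (P x u) = P' x u"
proof -
  have lin: "linear (P x)" if "x \<in> S" for x
    using that by (rule smooth_linear_onD(1)[OF P])
  have lin': "linear (P' x)" if "x \<in> S" for x
    using that by (rule smooth_linear_onD(1)[OF P'])
  have sub: "subspace (range (P x))" if "x \<in> S" for x
    using lin[OF that] by (rule linear_subspace_image) simp
  obtain B where B: "pairwise orthogonal B" "\<And>b. b \<in> B \<Longrightarrow> norm b = 1" "card B = dim (range (P a))"
      "span B = range (P a)" "independent B"
    using orthonormal_basis_subspace[OF sub[OF S(2)]] by metis
  have finB: "finite B" using B(5) by (rule independent_imp_finite)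
  \<comment> \<open>Orthogonal projection onto the image of \<open>P a\<close>, written in an
    orthonormal basis. It does not depend on \<open>x\<close>, so \<open>G\<close> inherits
    smoothness from \<open>P\<close>.\<close>
  define pr where "pr = (\<lambda>v. \<Sum>b\<in>B. (v \<bullet> b) *\<^sub>R b)"
  have pr_lin: "linear pr"
    unfolding pr_def
    by (intro linearI) (simp_all add: inner_add_left scaleR_add_left sum.distrib scaleR_sum_right)
  have pr_span: "pr v \<in> span B" for v
    unfolding pr_def by (intro span_sum span_scale span_base)
  have pr_dot: "pr v \<bullet> b = v \<bullet> b" if "b \<in> B" for v b
  proof -
    have "pr v \<bullet> b = (\<Sum>c\<in>B. (v \<bullet> c) * (c \<bullet> b))"
      by (simp add: pr_def inner_sum_left)
    also have "\<dots> = (\<Sum>c\<in>B. if c = b then v \<bullet> b else 0)"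
      using B(1,2) that
      by (intro sum.cong) (auto simp: pairwise_def orthogonal_def dot_square_norm)
    finally show ?thesis using that finB by simp
  qed
  have pr_orth: "(v - pr v) \<bullet> s = 0" if "s \<in> span B" for v s
    using orthogonal_to_span[OF that, of "v - pr v"] pr_dot
    by (simp add: orthogonal_def inner_diff_left)
  have pr_id: "pr s = s" if "s \<in> span B" for s
    using pr_orth[OF span_diff[OF that pr_span[of s]], of s] by simp
  define G where "G = (\<lambda>x v. P x (pr v) + (v - pr v))"
  have G: "smooth_linear_on S G"
    unfolding smooth_linear_on_def
  proof (intro conjI ballI allI)
    show "linear (G x)" if "x \<in> S" for x
      using lin[OF that] pr_lin unfolding G_def
      by (intro linearI) (simp_all add: linear_add linear_scale algebra_simps)
    show "smooth_on S (\<lambda>x. G x v)" for v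
      unfolding G_def by (intro smooth_intros S smooth_linear_onD(2)[OF P])
  qed
  have "inj (G a)"
    unfolding linear_injective_0[OF smooth_linear_onD(1)[OF G S(2)]]
  proof (intro allI impI)
    fix v assume 0: "G a v = 0"
    \<comment> \<open>\<open>G a v\<close> is the sum of a vector in the image of \<open>P a\<close>
      and one perpendicular to it; pairing with the perpendicular part isolates its norm.\<close>
    have "(v - pr v) \<bullet> P a (pr v) = 0" by (rule pr_orth) (simp add: B)
    with 0 have "(v - pr v) \<bullet> (v - pr v) = 0"
      by (metis G_def inner_add_right inner_zero_right add_0)
    then have v: "pr v = v" by simp
    then have 1: "P a v = 0" using 0 by (simp add: G_def)
    \<comment> \<open>Now \<open>v\<close> lies in both the kernel and the image of
      \<open>P a\<close>, which are orthogonal because the map is skew.\<close>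
    have "v \<in> range (P a)" using pr_span[of v] v B(4) by metis
    then obtain y where "v = P a y" by blast
    then have "v \<bullet> v = 0" using skew[OF S(2), of y v] 1 by simp
    then show "v = 0" by simp
  qed
  then obtain U H where U: "open U" "a \<in> U" "U \<subseteq> S" and H: "smooth_linear_on U H"
    and inv: "\<And>x v. x \<in> U \<Longrightarrow> H x (G x v) = v"
    by (rule smooth_local_left_inverse[OF S G]) (rule that)
  show thesis
  proof
    show "smooth_linear_on U (\<lambda>x v. P' x (pr (H x v)))"
      by (rule smooth_linear_on_compose[OF U(1) smooth_linear_on_subset[OF P' U(3)]
          smooth_linear_on_compose[OF U(1) smooth_linear_on_const[OF U(1) pr_lin] H]])
    fix x u assume x: "x \<in> U"
    then have xS: "x \<in> S" using U by blast
    \<comment> \<open>On \<open>span B\<close> the projection is the identity, so \<open>G x\<close>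
      restricts to \<open>P x\<close> there and \<open>H x\<close> undoes it.\<close>
    have HP: "H x (P x s) = s" if "s \<in> span B" for s
      using inv[OF x, of s] that by (simp add: G_def pr_id)
    have "inj_on (P x) (span B)"
      using HP by (metis inj_onI)
    \<comment> \<open>Injectivity preserves the dimension, and the rank at \<open>x\<close> equals
      that at \<open>a\<close>; so the image of \<open>span B\<close> under \<open>P x\<close> fills
      the range of \<open>P x\<close>.\<close>
    then have "dim (P x ` span B) = dim (span B)"
      by (intro dim_image_eq lin[OF xS]) (simp only: span_span)
    then have "dim (P x ` span B) = dim (range (P x))"
      using rank[OF xS] rank[OF S(2)] B(4) by simp
    then have "P x ` span B = range (P x)"
      by (intro subspace_dim_equal linear_subspace_image lin[OF xS] subspace_span sub[OF xS]) auto
    then obtain s where s: "s \<in> span B" "P x u = P x s" by (metis rangeI image_iff)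
    have "P x (u - s) = 0" using s lin[OF xS] by (simp add: linear_diff)
    \<comment> \<open>Equal images force equal kernels: \<open>P' x (P' x (u - s))\<close> lies in
      the range of \<open>P x\<close>, hence is orthogonal to the kernel element
      \<open>u - s\<close>, and skewness of \<open>P' x\<close> turns this into a vanishing
      norm.\<close>
    moreover obtain y where "P' x (P' x (u - s)) = P x y"
      using range[OF xS] by (metis rangeI image_iff)
    ultimately have "P' x (u - s) \<bullet> P' x (u - s) = 0"
      using skew'[OF xS, of "u - s" "P' x (u - s)"] skew[OF xS, of y "u - s"] by simp
    then have "P' x u = P' x s" using lin'[OF xS] by (simp add: linear_diff)
    then show "P' x (pr (H x (P x u))) = P' x u"
      using s HP pr_id by simp
  qed (use U in auto)
qed

section \<open>Tangent and cotangent spaces in charts\<close>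

lemma sum_fun_apply: "(\<Sum>i\<in>I. f i) x = (\<Sum>i\<in>I. f i x)"
  by (induction I rule: infinite_finite_induct) auto

locale smooth_atlas =
  fixes Z :: "'a topology" and A :: "('a, 'e::euclidean_space) chart set"
  assumes manifold: "smooth_manifold Z A"
begin

lemma is_chart: "c \<in> A \<Longrightarrow> is_chart Z c"
  using manifold by (simp add: smooth_manifold_def)

lemma openin_chart_dom: "c \<in> A \<Longrightarrow> openin Z (chart_dom c)"
  using is_chart by (simp add: is_chart_def)

lemma open_chart_image: "c \<in> A \<Longrightarrow> open (chart_image c)"
  using is_chart by (simp add: is_chart_def)

lemma chart_dom_subset: "c \<in> A \<Longrightarrow> chart_dom c \<subseteq> topspace Z"
  by (rule openin_subset[OF openin_chart_dom])

lemma topspace_subtopology_chart: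
  "c \<in> A \<Longrightarrow> topspace (subtopology Z (chart_dom c)) = chart_dom c"
  by (simp add: chart_dom_subset Int_absorb1)

lemma chart_cover:
  assumes "p \<in> topspace Z"
  obtains c where "c \<in> A" "p \<in> chart_dom c"
  using assms manifold unfolding smooth_manifold_def by blast

lemma homeomorphic_map_chart:
  "c \<in> A \<Longrightarrow> homeomorphic_map (subtopology Z (chart_dom c)) (top_of_set (chart_image c)) (chart_map c)"
  using is_chart by (simp add: is_chart_def)

lemma inj_on_chart: "c \<in> A \<Longrightarrow> inj_on (chart_map c) (chart_dom c)"
  using homeomorphic_imp_injective_map[OF homeomorphic_map_chart] topspace_subtopology_chart by metis

lemma chart_inv_chart_map [simp]:
  "c \<in> A \<Longrightarrow> p \<in> chart_dom c \<Longrightarrow> chart_inv c (chart_map c p) = p"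
  by (rule inv_into_f_f[OF inj_on_chart])

lemma openin_chart_preimage:
  assumes "c \<in> A" "open V"
  shows "openin Z {p \<in> chart_dom c. chart_map c p \<in> V}"
proof -
  have "openin (subtopology Z (chart_dom c))
      {p \<in> topspace (subtopology Z (chart_dom c)). chart_map c p \<in> chart_image c \<inter> V}"
    by (rule openin_continuous_map_preimage[OF homeomorphic_imp_continuous_map[OF homeomorphic_map_chart[OF assms(1)]]
        openin_open_Int[OF assms(2)]])
  moreover have "{p \<in> topspace (subtopology Z (chart_dom c)). chart_map c p \<in> chart_image c \<inter> V} =
      {p \<in> chart_dom c. chart_map c p \<in> V}"
    unfolding topspace_subtopology_chart[OF assms(1)] by auto
  ultimately show ?thesis
    using openin_chart_dom[OF assms(1)] openin_trans_full by metis
qed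

lemma open_chart_map_image:
  assumes "c \<in> A" "openin Z W"
  shows "open (chart_map c ` (chart_dom c \<inter> W))"
proof -
  have "openin (top_of_set (chart_image c)) (chart_map c ` (chart_dom c \<inter> W))"
    using homeomorphic_imp_open_map[OF homeomorphic_map_chart[OF assms(1)]] assms(2)
    unfolding open_map_def by (metis openin_subtopology_Int2)
  then show ?thesis
    using open_chart_image[OF assms(1)] openin_open_trans by blast
qed

text \<open>The chart pulls \<open>K\<close> back to a compact set, which is closed because
  \<open>Z\<close> is Hausdorff. Hence supports of cut-off functions are closed in all of
  \<open>Z\<close>, not merely in the chart domain.\<close>

lemma closedin_chart_preimage:
  assumes "c \<in> A" "compact K" "K \<subseteq> chart_image c"
  shows "closedin Z {p \<in> chart_dom c. chart_map c p \<in> K}"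
proof -
  have "compactin (top_of_set (chart_image c)) K"
    using assms(2,3) by (simp add: compactin_subtopology)
  moreover have "chart_map c ` {p \<in> chart_dom c. chart_map c p \<in> K} = K"
    using assms(3) by auto
  ultimately have "compactin (subtopology Z (chart_dom c)) {p \<in> chart_dom c. chart_map c p \<in> K}"
    using homeomorphic_map_compactness[OF homeomorphic_map_chart[OF assms(1)],
        of "{p \<in> chart_dom c. chart_map c p \<in> K}", unfolded topspace_subtopology_chart[OF assms(1)]]
    by (metis (no_types, lifting) mem_Collect_eq subsetI)
  then have "compactin Z {p \<in> chart_dom c. chart_map c p \<in> K}"
    by (simp add: compactin_subtopology)
  then show ?thesis
    using manifold compactin_imp_closedin unfolding smooth_manifold_def by blast
qed

abbreviation overlap :: "('a, 'e) chart \<Rightarrow> ('a, 'e) chart \<Rightarrow> 'e set"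
  where "overlap c d \<equiv> chart_map c ` (chart_dom c \<inter> chart_dom d)"

abbreviation trans_deriv :: "('a, 'e) chart \<Rightarrow> ('a, 'e) chart \<Rightarrow> 'a \<Rightarrow> 'e \<Rightarrow> 'e"
  where "trans_deriv c d p \<equiv> frechet_derivative (transition c d) (at (chart_map c p))"

lemma open_overlap: "c \<in> A \<Longrightarrow> d \<in> A \<Longrightarrow> open (overlap c d)"
  by (rule open_chart_map_image[OF _ openin_chart_dom])

lemma smooth_on_transition: "c \<in> A \<Longrightarrow> d \<in> A \<Longrightarrow> smooth_on (overlap c d) (transition c d)"
  using manifold by (simp add: smooth_manifold_def)

lemma transition_chart_map [simp]:
  "c \<in> A \<Longrightarrow> p \<in> chart_dom c \<Longrightarrow> transition c d (chart_map c p) = chart_map d p"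
  by (simp add: transition_def)

lemma has_derivative_transition:
  assumes "c \<in> A" "d \<in> A" "p \<in> chart_dom c" "p \<in> chart_dom d"
  shows "(transition c d has_derivative trans_deriv c d p) (at (chart_map c p))"
  using assms by (intro smooth_on_has_derivative[OF smooth_on_transition]) auto

lemma linear_trans_deriv:
  assumes "c \<in> A" "d \<in> A" "p \<in> chart_dom c" "p \<in> chart_dom d"
  shows "linear (trans_deriv c d p)"
  using has_derivative_linear[OF has_derivative_transition[OF assms]] .

lemma trans_deriv_self:
  assumes "c \<in> A" "p \<in> chart_dom c"
  shows "trans_deriv c c p u = u"
proof -
  have "((\<lambda>x. x) has_derivative trans_deriv c c p) (at (chart_map c p))"
    by (rule has_derivative_transform_within_open[OF has_derivative_transition[OF assms(1,1,2,2)]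
        open_chart_image[OF assms(1)]]) (use assms in auto)
  then show ?thesis
    using has_derivative_unique[OF _ has_derivative_ident] by metis
qed

text \<open>The cocycle rule that makes \<open>coord_vec\<close> compatible across charts. The
  composite of the transition maps agrees with the direct one on an open overlap, so the chain rule
  applies.\<close>

lemma trans_deriv_trans_deriv:
  assumes "c \<in> A" "d \<in> A" "e \<in> A" "p \<in> chart_dom c" "p \<in> chart_dom d" "p \<in> chart_dom e"
  shows "trans_deriv d e p (trans_deriv c d p u) = trans_deriv c e p u"
proof -
  have "((\<lambda>x. transition d e (transition c d x)) has_derivative (\<lambda>u. trans_deriv d e p (trans_deriv c d p u)))
      (at (chart_map c p))"
    by (rule has_derivative_compose[OF has_derivative_transition[OF assms(1,2,4,5)]])
      (use has_derivative_transition[OF assms(2,3,5,6)] assms in simp)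
  then have "(transition c e has_derivative (\<lambda>u. trans_deriv d e p (trans_deriv c d p u))) (at (chart_map c p))"
    by (rule has_derivative_transform_within_open[OF _ open_overlap[OF assms(1,2)]])
      (use assms in auto)
  then show ?thesis
    using has_derivative_unique[OF _ has_derivative_transition[OF assms(1,3,4,6)]] by metis
qed

lemma coord_vec_apply:
  "d \<in> A \<Longrightarrow> p \<in> chart_dom d \<Longrightarrow> coord_vec A c u p d = trans_deriv c d p u"
  by (simp add: coord_vec_def charts_at_def)

lemma coord_vec_self: "c \<in> A \<Longrightarrow> p \<in> chart_dom c \<Longrightarrow> coord_vec A c u p c = u"
  by (simp add: coord_vec_apply trans_deriv_self)

lemma coord_vec_in_tangent_space:
  assumes "c \<in> A" "p \<in> chart_dom c"
  shows "coord_vec A c u p \<in> tangent_space A p"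
  using assms by (simp add: tangent_space_def coord_vec_def charts_at_def trans_deriv_trans_deriv
      del: split_paired_All)

text \<open>The compatibility condition recovers every component from the one in \<open>c\<close>;
  off \<open>charts_at A p\<close> both sides take the default value 0.\<close>

lemma tangent_eq_coord_vec:
  assumes "c \<in> A" "p \<in> chart_dom c" "v \<in> tangent_space A p"
  shows "v = coord_vec A c (v c) p"
proof (rule ext)
  fix d
  have c: "c \<in> charts_at A p" using assms by (simp add: charts_at_def)
  note v = CollectD[OF assms(3)[unfolded tangent_space_def]]
  show "v d = coord_vec A c (v c) p d"
  proof (cases "d \<in> charts_at A p")
    case True
    then show ?thesis
      using bspec[OF bspec[OF conjunct2[OF v] c] True] by (simp add: coord_vec_def)
  next
    case False
    then show ?thesis
      using conjunct1[OF v, rule_format, OF False] by (simp add: coord_vec_def)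
  qed
qed

lemma linear_coord_vec:
  assumes "c \<in> A" "p \<in> chart_dom c"
  shows "linear (\<lambda>u. coord_vec A c u p)"
  using linear_trans_deriv[OF assms(1) _ assms(2)]
  by (intro linearI ext) (simp_all add: coord_vec_def charts_at_def linear_add linear_scale)

lemma inj_coord_vec:
  assumes "c \<in> A" "p \<in> chart_dom c"
  shows "inj (\<lambda>u. coord_vec A c u p)"
  by (rule injI) (metis coord_vec_self[OF assms])

lemma tangent_space_eq:
  assumes "c \<in> A" "p \<in> chart_dom c"
  shows "tangent_space A p = range (\<lambda>u. coord_vec A c u p)"
  using tangent_eq_coord_vec[OF assms] coord_vec_in_tangent_space[OF assms] by blast

lemma subspace_tangent_space: "p \<in> topspace Z \<Longrightarrow> subspace (tangent_space A p)"
  by (metis chart_cover tangent_space_eq linear_subspace_image linear_coord_vec subspace_UNIV)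

lemma coord_covec_coord_vec:
  "c \<in> A \<Longrightarrow> p \<in> chart_dom c \<Longrightarrow> coord_covec A c a p (coord_vec A c u p) = u \<bullet> a"
  by (simp add: coord_covec_def coord_vec_in_tangent_space coord_vec_self)

lemma coord_covec_in_cotangent_space:
  assumes "c \<in> A" "p \<in> chart_dom c"
  shows "coord_covec A c a p \<in> cotangent_space A p"
proof -
  have "subspace (tangent_space A p)"
    using subspace_tangent_space chart_dom_subset assms by blast
  then show ?thesis
    by (auto simp: cotangent_space_def linear_on_def coord_covec_def subspace_add subspace_scale
        inner_add_left)
qed

lemma cotangent_eq_coord_covec:
  assumes "c \<in> A" "p \<in> chart_dom c" "\<alpha> \<in> cotangent_space A p"
  obtains a where "\<alpha> = coord_covec A c a p"
proof
  have "linear (\<lambda>u. \<alpha> (coord_vec A c u p))"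
    using assms(3) coord_vec_in_tangent_space[OF assms(1,2)]
    by (intro linearI) (simp_all add: cotangent_space_def linear_on_def
        linear_add[OF linear_coord_vec[OF assms(1,2)]] linear_scale[OF linear_coord_vec[OF assms(1,2)]])
  \<comment> \<open>Riesz representation: the adjoint of a real functional, evaluated at 1, is its
    representing vector.\<close>
  then have "\<alpha> (coord_vec A c u p) = u \<bullet> adjoint (\<lambda>u. \<alpha> (coord_vec A c u p)) 1" for u
    using adjoint_works[of "\<lambda>u. \<alpha> (coord_vec A c u p)" u 1] by simp
  then have "\<alpha> v = v c \<bullet> adjoint (\<lambda>u. \<alpha> (coord_vec A c u p)) 1" if "v \<in> tangent_space A p" for v
    using tangent_eq_coord_vec[OF assms(1,2) that] by metis
  then show "\<alpha> = coord_covec A c (adjoint (\<lambda>u. \<alpha> (coord_vec A c u p)) 1) p"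
    using assms(3) by (auto simp: coord_covec_def cotangent_space_def fun_eq_iff)
qed

lemma cotangent_space_eq:
  assumes "c \<in> A" "p \<in> chart_dom c"
  shows "cotangent_space A p = range (\<lambda>a. coord_covec A c a p)"
  using cotangent_eq_coord_covec[OF assms] coord_covec_in_cotangent_space[OF assms] by blast

lemma linear_coord_covec:
  "linear (\<lambda>a. coord_covec A c a p)"
  by (intro linearI) (auto simp: fun_eq_iff coord_covec_def inner_add_right)

text \<open>The coordinate covectors of a single chart already separate tangent vectors. This
  supplies the uniqueness behind the definite description in \<open>contraction\<close>.\<close>

lemma tangent_eqI:
  assumes "p \<in> topspace Z" "u \<in> tangent_space A p" "v \<in> tangent_space A p"
    "\<And>\<beta>. \<beta> \<in> cotangent_space A p \<Longrightarrow> \<beta> u = \<beta> v"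
  shows "u = v"
proof -
  obtain c where c: "c \<in> A" "p \<in> chart_dom c" using chart_cover[OF assms(1)] .
  have "u c \<bullet> b = v c \<bullet> b" for b
    using assms(4)[OF coord_covec_in_cotangent_space[OF c, of b]] assms(2,3)
    by (simp add: coord_covec_def)
  then have "u c = v c" by (metis vector_eq_rdot)
  then show ?thesis
    using tangent_eq_coord_vec[OF c] assms(2,3) by metis
qed

section \<open>Bivectors and sharp maps in coordinates\<close>

definition comp_map :: "('a \<Rightarrow> ('a, 'e) bivector) \<Rightarrow> ('a, 'e) chart \<Rightarrow> 'e \<Rightarrow> 'e \<Rightarrow> 'e"
  where "comp_map w c x a = (\<Sum>j\<in>Basis. (\<Sum>i\<in>Basis. (a \<bullet> i) * bivec_comp A c w i j x) *\<^sub>R j)"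

lemma smooth_linear_on_comp_map:
  assumes "c \<in> A" "bivector_field Z A w"
  shows "smooth_linear_on (chart_image c) (comp_map w c)"
  unfolding smooth_linear_on_def
proof (intro conjI ballI allI)
  show "linear (comp_map w c x)" for x
    unfolding comp_map_def
    by (intro linearI) (simp_all add: inner_add_left scaleR_add_left distrib_right sum.distrib
        scaleR_sum_right sum_distrib_left mult.assoc)
  have "smooth_on (chart_image c) (bivec_comp A c w i j)" if "i \<in> Basis" "j \<in> Basis" for i j
    using assms that by (simp add: bivector_field_def)
  then show "smooth_on (chart_image c) (\<lambda>x. comp_map w c x v)" for v
    unfolding comp_map_def by (intro smooth_intros open_chart_image[OF assms(1)])
qed

lemma bivector_linear:
  assumes "bivector_field Z A w" "p \<in> topspace Z" "\<alpha> \<in> cotangent_space A p"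
  shows "linear_on (cotangent_space A p) (\<lambda>\<beta>. w p \<alpha> \<beta>)"
    "linear_on (cotangent_space A p) (\<lambda>\<beta>. w p \<beta> \<alpha>)" "w p \<alpha> \<alpha> = 0"
  using assms by (auto simp: bivector_field_def)

text \<open>Polarisation: the alternating condition is expanded at
  \<open>\<alpha> + \<beta>\<close>.\<close>

lemma bivector_skew:
  assumes "bivector_field Z A w" "p \<in> topspace Z" "\<alpha> \<in> cotangent_space A p" "\<beta> \<in> cotangent_space A p"
  shows "w p \<alpha> \<beta> = - w p \<beta> \<alpha>"
proof -
  obtain c where c: "c \<in> A" "p \<in> chart_dom c" using chart_cover[OF assms(2)] .
  have ab: "\<alpha> + \<beta> \<in> cotangent_space A p"
    unfolding cotangent_space_eq[OF c]
    by (rule subspace_add[OF linear_subspace_image[OF linear_coord_covec subspace_UNIV]])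
      (use assms(3,4) cotangent_space_eq[OF c] in simp_all)
  have "w p (\<alpha> + \<beta>) (\<alpha> + \<beta>) = w p (\<alpha> + \<beta>) \<alpha> + w p (\<alpha> + \<beta>) \<beta>"
    using bivector_linear(1)[OF assms(1,2) ab] assms(3,4) unfolding linear_on_def by blast
  also have "w p (\<alpha> + \<beta>) \<alpha> = w p \<alpha> \<alpha> + w p \<beta> \<alpha>"
    using bivector_linear(2)[OF assms(1,2,3)] assms(3,4) unfolding linear_on_def by blast
  also have "w p (\<alpha> + \<beta>) \<beta> = w p \<alpha> \<beta> + w p \<beta> \<beta>"
    using bivector_linear(2)[OF assms(1,2,4)] assms(3,4) unfolding linear_on_def by blast
  finally show ?thesis
    using bivector_linear(3)[OF assms(1,2) ab] bivector_linear(3)[OF assms(1,2,3)]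
      bivector_linear(3)[OF assms(1,2,4)] by linarith
qed

lemma comp_map_inner:
  assumes "bivector_field Z A w" "c \<in> A" "p \<in> chart_dom c"
  shows "comp_map w c (chart_map c p) a \<bullet> b = w p (coord_covec A c a p) (coord_covec A c b p)"
proof -
  have p: "p \<in> topspace Z" using chart_dom_subset assms(2,3) by blast
  note cv = coord_covec_in_cotangent_space[OF assms(2,3)]
  have l1: "linear (\<lambda>a. w p (coord_covec A c a p) (coord_covec A c b p))" for b
    using bivector_linear(2)[OF assms(1) p cv[of b]] cv
    by (intro linearI) (simp_all add: linear_on_def linear_add[OF linear_coord_covec] linear_scale[OF linear_coord_covec])
  have l2: "linear (\<lambda>b. w p (coord_covec A c a p) (coord_covec A c b p))" for a
    using bivector_linear(1)[OF assms(1) p cv[of a]] cv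
    by (intro linearI) (simp_all add: linear_on_def linear_add[OF linear_coord_covec] linear_scale[OF linear_coord_covec])
  have expand: "f u = (\<Sum>i\<in>Basis. (u \<bullet> i) * f i)" if "linear f" for f :: "'e \<Rightarrow> real" and u
    using linear_sum[OF that, of "\<lambda>i. (u \<bullet> i) *\<^sub>R i" Basis]
    by (simp add: euclidean_representation linear_scale[OF that])
  have "comp_map w c (chart_map c p) a \<bullet> b =
      (\<Sum>j\<in>Basis. (\<Sum>i\<in>Basis. (a \<bullet> i) * w p (coord_covec A c i p) (coord_covec A c j p)) * (j \<bullet> b))"
    using assms(2,3) by (simp add: comp_map_def inner_sum_left bivec_comp_def)
  also have "\<dots> = (\<Sum>j\<in>Basis. (b \<bullet> j) * w p (coord_covec A c a p) (coord_covec A c j p))"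
    by (intro sum.cong refl) (subst expand[OF l1, of a], simp add: mult.commute inner_commute[of b])
  also have "\<dots> = w p (coord_covec A c a p) (coord_covec A c b p)"
    by (rule expand[OF l2, symmetric])
  finally show ?thesis .
qed

text \<open>The minus sign in \<open>sharp\<close> cancels the one from exchanging the two slots of
  \<open>w\<close>, so \<open>comp_map\<close>, which contracts the first index, is exactly the
  coordinate form of \<open>sharp\<close>.\<close>

lemma sharp_coord_covec:
  assumes "bivector_field Z A w" "c \<in> A" "p \<in> chart_dom c"
  shows "sharp A w p (coord_covec A c a p) = coord_vec A c (comp_map w c (chart_map c p) a) p"
proof -
  have p: "p \<in> topspace Z" using chart_dom_subset assms(2,3) by blast
  note cv = coord_covec_in_cotangent_space[OF assms(2,3)]
  let ?v = "coord_vec A c (- comp_map w c (chart_map c p) a) p"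
  have v: "\<beta> ?v = w p \<beta> (coord_covec A c a p)" if "\<beta> \<in> cotangent_space A p" for \<beta>
  proof -
    obtain b where b: "\<beta> = coord_covec A c b p"
      using cotangent_eq_coord_covec[OF assms(2,3) \<open>\<beta> \<in> cotangent_space A p\<close>] .
    show ?thesis
      unfolding b coord_covec_coord_vec[OF assms(2,3)]
      using comp_map_inner[OF assms, of a b] bivector_skew[OF assms(1) p cv cv, of a b] by simp
  qed
  have "contraction A w p (coord_covec A c a p) = ?v"
    unfolding contraction_def
  proof (rule the_equality)
    show "?v \<in> tangent_space A p \<and> (\<forall>\<beta>\<in>cotangent_space A p. \<beta> ?v = w p \<beta> (coord_covec A c a p))"
      using v coord_vec_in_tangent_space[OF assms(2,3)] by blast
  next
    fix u
    assume u: "u \<in> tangent_space A p \<and> (\<forall>\<beta>\<in>cotangent_space A p. \<beta> u = w p \<beta> (coord_covec A c a p))"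
    show "u = ?v"
      by (rule tangent_eqI[OF p conjunct1[OF u] coord_vec_in_tangent_space[OF assms(2,3)]])
        (simp only: v bspec[OF conjunct2[OF u]])
  qed
  then show ?thesis
    using linear_neg[OF linear_coord_vec[OF assms(2,3)], of "comp_map w c (chart_map c p) a"]
    by (simp add: sharp_def)
qed

lemma sharp_in_tangent_space:
  assumes "bivector_field Z A w" "p \<in> topspace Z" "\<alpha> \<in> cotangent_space A p"
  shows "sharp A w p \<alpha> \<in> tangent_space A p"
proof -
  obtain c where c: "c \<in> A" "p \<in> chart_dom c" using chart_cover[OF assms(2)] .
  obtain a where a: "\<alpha> = coord_covec A c a p"
    using cotangent_eq_coord_covec[OF c assms(3)] .
  show ?thesis
    unfolding a sharp_coord_covec[OF assms(1) c] by (rule coord_vec_in_tangent_space[OF c])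
qed

lemma cotangent_sharp:
  assumes "bivector_field Z A w" "p \<in> topspace Z" "\<alpha> \<in> cotangent_space A p" "\<beta> \<in> cotangent_space A p"
  shows "\<beta> (sharp A w p \<alpha>) = w p \<alpha> \<beta>"
proof -
  obtain c where c: "c \<in> A" "p \<in> chart_dom c" using chart_cover[OF assms(2)] .
  obtain a where a: "\<alpha> = coord_covec A c a p"
    using cotangent_eq_coord_covec[OF c assms(3)] .
  obtain b where b: "\<beta> = coord_covec A c b p"
    using cotangent_eq_coord_covec[OF c assms(4)] .
  show ?thesis
    unfolding a b sharp_coord_covec[OF assms(1) c] coord_covec_coord_vec[OF c]
    by (rule comp_map_inner[OF assms(1) c])
qed

lemma sharp_image:
  assumes "bivector_field Z A w" "c \<in> A" "p \<in> chart_dom c"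
  shows "sharp A w p ` cotangent_space A p =
    (\<lambda>u. coord_vec A c u p) ` range (comp_map w c (chart_map c p))"
  unfolding cotangent_space_eq[OF assms(2,3)] image_image sharp_coord_covec[OF assms] ..

lemma dim_sharp_image:
  assumes "bivector_field Z A w" "c \<in> A" "p \<in> chart_dom c"
  shows "dim (sharp A w p ` cotangent_space A p) = dim (range (comp_map w c (chart_map c p)))"
  unfolding sharp_image[OF assms]
  by (intro dim_image_eq linear_coord_vec assms inj_on_subset[OF inj_coord_vec] subset_UNIV)

text \<open>The dimension argument is carried out in a chart, where the images become subspaces of
  the Euclidean model space instead of a function space.\<close>

lemma sharp_image_eqI:
  assumes "bivector_field Z A w" "bivector_field Z A w'" "p \<in> topspace Z"
    "sharp A w' p ` cotangent_space A p \<subseteq> sharp A w p ` cotangent_space A p"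
    "dim (sharp A w p ` cotangent_space A p) = dim (sharp A w' p ` cotangent_space A p)"
  shows "sharp A w' p ` cotangent_space A p = sharp A w p ` cotangent_space A p"
proof -
  obtain c where c: "c \<in> A" "p \<in> chart_dom c" using chart_cover[OF assms(3)] .
  have x: "chart_map c p \<in> chart_image c" using c by simp
  have "range (comp_map w' c (chart_map c p)) = range (comp_map w c (chart_map c p))"
  proof (rule subspace_dim_equal)
    show "range (comp_map w' c (chart_map c p)) \<subseteq> range (comp_map w c (chart_map c p))"
      using assms(4) unfolding sharp_image[OF assms(1) c] sharp_image[OF assms(2) c]
      by (simp add: inj_image_subset_iff[OF inj_coord_vec[OF c]])
    show "dim (range (comp_map w c (chart_map c p))) \<le> dim (range (comp_map w' c (chart_map c p)))"
      using assms(5) dim_sharp_image[OF assms(1) c] dim_sharp_image[OF assms(2) c] by simp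
  qed (intro linear_subspace_image smooth_linear_onD(1)[OF smooth_linear_on_comp_map[OF c(1)] x] assms subspace_UNIV)+
  then show ?thesis
    unfolding sharp_image[OF assms(1) c] sharp_image[OF assms(2) c] by simp
qed

section \<open>Cutting off and gluing tensor fields\<close>

text \<open>Smoothness is local, and the open sets \<open>V\<close> and the complement of
  \<open>K\<close> cover the manifold; on the latter \<open>F\<close> is identically 0.\<close>

lemma smooth_on_extend_by_zero:
  fixes F :: "'a \<Rightarrow> real"
  assumes "d \<in> A" "openin Z V" "closedin Z K" "K \<subseteq> V" "\<And>q. q \<notin> K \<Longrightarrow> F q = 0"
    and smooth: "smooth_on (chart_map d ` (chart_dom d \<inter> V)) (\<lambda>x. F (chart_inv d x))"
  shows "smooth_on (chart_image d) (\<lambda>x. F (chart_inv d x))"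
proof (rule smooth_on_local)
  fix x assume "x \<in> chart_image d"
  then obtain q where q: "q \<in> chart_dom d" "x = chart_map d q" by blast
  show "\<exists>U. open U \<and> x \<in> U \<and> smooth_on U (\<lambda>x. F (chart_inv d x))"
  proof (cases "q \<in> K")
    case True
    then have "x \<in> chart_map d ` (chart_dom d \<inter> V)" using q assms(4) by blast
    then show ?thesis
      using open_chart_map_image[OF assms(1,2)] smooth by blast
  next
    case False
    let ?W = "topspace Z - K"
    have W: "openin Z ?W" using assms(3) by blast
    have "smooth_on (chart_map d ` (chart_dom d \<inter> ?W)) (\<lambda>x. 0::real)"
      by (rule smooth_on_const)
    moreover have "F (chart_inv d y) = 0" if "y \<in> chart_map d ` (chart_dom d \<inter> ?W)" for y
      using that assms(1,5) by auto
    ultimately have "smooth_on (chart_map d ` (chart_dom d \<inter> ?W)) (\<lambda>x. F (chart_inv d x))"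
      using smooth_on_cong[OF open_chart_map_image[OF assms(1) W], of "\<lambda>x. F (chart_inv d x)" "\<lambda>x. 0"]
      by blast
    moreover have "x \<in> chart_map d ` (chart_dom d \<inter> ?W)"
      using q False chart_dom_subset[OF assms(1)] by blast
    ultimately show ?thesis
      using open_chart_map_image[OF assms(1) W] by blast
  qed
qed

lemma smooth_linear_on_trans_deriv:
  assumes "c \<in> A" "d \<in> A"
  shows "smooth_linear_on (overlap c d) (\<lambda>x. trans_deriv c d (chart_inv c x))"
  unfolding smooth_linear_on_def
proof (intro conjI ballI allI)
  show "linear (trans_deriv c d (chart_inv c x))" if "x \<in> overlap c d" for x
    using that assms by (auto intro!: linear_trans_deriv)
  have "smooth_on (overlap c d) (\<lambda>x. frechet_derivative (transition c d) (at x) v)" for v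
    by (rule smooth_on_frechet_derivative[OF smooth_on_transition[OF assms]])
  then show "smooth_on (overlap c d) (\<lambda>x. trans_deriv c d (chart_inv c x) v)" for v
    by (rule smooth_on_cong[OF open_overlap[OF assms], THEN iffD1, rotated]) (use assms in auto)
qed

text \<open>Reparametrises a family from chart \<open>c\<close> to chart \<open>d\<close>.
  \<open>V'\<close> is kept apart from \<open>V\<close> so that the rule serves both families known
  on \<open>V\<close> alone and transition derivatives, known on a whole overlap.\<close>

lemma smooth_linear_on_compose_transition:
  assumes "c \<in> A" "d \<in> A" "openin Z V" "V \<subseteq> chart_dom c"
    and L: "smooth_linear_on (chart_map c ` (chart_dom c \<inter> V')) L" "openin Z V'" "chart_dom d \<inter> V \<subseteq> V'"
  shows "smooth_linear_on (chart_map d ` (chart_dom d \<inter> V)) (\<lambda>x. L (chart_map c (chart_inv d x)))"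
  unfolding smooth_linear_on_def
proof (intro conjI ballI allI)
  let ?O = "chart_map d ` (chart_dom d \<inter> V)"
  have sub: "chart_map c (chart_inv d x) \<in> chart_map c ` (chart_dom c \<inter> V')" if "x \<in> ?O" for x
    using that assms by auto
  then show "linear (L (chart_map c (chart_inv d x)))" if "x \<in> ?O" for x
    using that smooth_linear_onD(1)[OF L(1)] by blast
  have "?O \<subseteq> overlap d c" using assms(4) by auto
  then have "smooth_on ?O (\<lambda>x. chart_map c (chart_inv d x))"
    using smooth_on_subset[OF smooth_on_transition[OF assms(2,1)]] by (simp add: transition_def o_def)
  then show "smooth_on ?O (\<lambda>x. L (chart_map c (chart_inv d x)) v)" for v
    by (rule smooth_on_compose[OF smooth_linear_onD(2)[OF L(1)]])
      (use sub open_chart_map_image assms L(2) in auto)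
qed

definition smooth_function :: "('a \<Rightarrow> real) \<Rightarrow> bool"
  where "smooth_function f \<longleftrightarrow> (\<forall>c\<in>A. smooth_on (chart_image c) (\<lambda>x. f (chart_inv c x)))"

lemma tensor_cutoff:
  assumes "c \<in> A" "open U" "U \<subseteq> chart_image c" "smooth_linear_on U M" "p \<in> chart_dom c" "chart_map c p \<in> U"
  obtains W f T where "openin Z W" "p \<in> W" "\<And>q. q \<in> W \<Longrightarrow> f q = 1"
    "smooth_function f" "tensor11_field Z A T"
    "\<And>q v. T q v = (if q \<in> chart_dom c \<and> chart_map c q \<in> U
        then f q *\<^sub>R coord_vec A c (M (chart_map c q) (v c)) q else 0)"
    "\<And>q. \<not> (q \<in> chart_dom c \<and> chart_map c q \<in> U) \<Longrightarrow> f q = 0"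
proof -
  obtain r where r: "r > 0" "cball (chart_map c p) r \<subseteq> U"
    using assms(2,6) open_contains_cball by blast
  obtain g :: "'e \<Rightarrow> real" where g: "smooth_on UNIV g"
    "\<And>x. x \<in> ball (chart_map c p) (r / 2) \<Longrightarrow> g x = 1"
    "\<And>x. x \<notin> ball (chart_map c p) r \<Longrightarrow> g x = 0"
    by (rule smooth_bump_function[OF r(1), of "chart_map c p"]) (rule that)
  \<comment> \<open>The sets are nested: the bump is 1 on \<open>W\<close>, is supported in the
    closed set \<open>K\<close>, and \<open>K\<close> lies in the open set \<open>V\<close> where
    \<open>M\<close> is available.\<close>
  define W where "W = {q \<in> chart_dom c. chart_map c q \<in> ball (chart_map c p) (r / 2)}"
  define V where "V = {q \<in> chart_dom c. chart_map c q \<in> U}"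
  define K where "K = {q \<in> chart_dom c. chart_map c q \<in> cball (chart_map c p) r}"
  define f where "f = (\<lambda>q. if q \<in> chart_dom c then g (chart_map c q) else 0)"
  define T where "T = (\<lambda>q v. if q \<in> V then f q *\<^sub>R coord_vec A c (M (chart_map c q) (v c)) q else 0)"
  have V: "openin Z V" "V \<subseteq> chart_dom c"
    unfolding V_def by (rule openin_chart_preimage[OF assms(1,2)]) auto
  have K: "closedin Z K"
    unfolding K_def using r assms(3) by (intro closedin_chart_preimage[OF assms(1)]) auto
  have KV: "K \<subseteq> V" using r by (auto simp: K_def V_def)
  have f0: "f q = 0" if "q \<notin> K" for q
    using that g(3)[of "chart_map c q"] by (auto simp: f_def K_def)
  have VU: "chart_map c ` (chart_dom c \<inter> V) \<subseteq> U" by (auto simp: V_def)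
  have sf: "smooth_on (chart_map d ` (chart_dom d \<inter> V)) (\<lambda>x. f (chart_inv d x))" if d: "d \<in> A" for d
  proof -
    let ?O = "chart_map d ` (chart_dom d \<inter> V)"
    have "?O \<subseteq> overlap d c" using V by auto
    then have "smooth_on ?O (\<lambda>x. chart_map c (chart_inv d x))"
      using smooth_on_subset[OF smooth_on_transition[OF d assms(1)]] by (simp add: transition_def o_def)
    then have "smooth_on ?O (\<lambda>x. g (chart_map c (chart_inv d x)))"
      by (rule smooth_on_compose[OF g(1)]) (use open_chart_map_image[OF d V(1)] in auto)
    then show ?thesis
      by (rule smooth_on_cong[OF open_chart_map_image[OF d V(1)], THEN iffD1, rotated])
        (use d V in \<open>auto simp: f_def\<close>)
  qed
  have "smooth_function f"
    unfolding smooth_function_def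
  proof
    fix d assume d: "d \<in> A"
    show "smooth_on (chart_image d) (\<lambda>x. f (chart_inv d x))"
      by (rule smooth_on_extend_by_zero[OF d V(1) K KV f0 sf[OF d]])
  qed
  moreover have "tensor11_field Z A T"
    unfolding tensor11_field_def
  proof (intro conjI ballI)
    fix q assume q: "q \<in> topspace Z"
    have sub: "subspace (tangent_space A q)" by (rule subspace_tangent_space[OF q])
    show "T q ` tangent_space A q \<subseteq> tangent_space A q"
    proof clarify
      fix v
      have "f q *\<^sub>R coord_vec A c (M (chart_map c q) (v c)) q \<in> tangent_space A q" if "q \<in> V"
        using V(2) that by (intro subspace_scale[OF sub] coord_vec_in_tangent_space[OF assms(1)]) auto
      then show "T q v \<in> tangent_space A q"
        using subspace_0[OF sub] by (simp add: T_def)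
    qed
    show "linear_on (tangent_space A q) (T q)"
    proof (cases "q \<in> V")
      case True
      then have qc: "q \<in> chart_dom c" and "chart_map c q \<in> U" by (auto simp: V_def)
      then have M: "linear (M (chart_map c q))" using smooth_linear_onD(1)[OF assms(4)] by blast
      note lc = linear_coord_vec[OF assms(1) qc]
      show ?thesis
        using True by (simp add: linear_on_def T_def linear_add[OF M] linear_scale[OF M]
            linear_add[OF lc] linear_scale[OF lc] scaleR_add_right)
    qed (simp add: T_def linear_on_def)
  next
    fix d :: "('a, 'e) chart" and i j :: 'e
    assume d: "d \<in> A" and "i \<in> Basis" "j \<in> Basis"
    let ?F = "\<lambda>q. T q (coord_vec A d i q) d \<bullet> j"
    let ?O = "chart_map d ` (chart_dom d \<inter> V)"
    have oO: "open ?O" by (rule open_chart_map_image[OF d V(1)])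
    \<comment> \<open>In chart \<open>d\<close> the tensor is \<open>M\<close> conjugated by
      transition derivatives: components pass from \<open>d\<close> to \<open>c\<close>, through
      \<open>M\<close>, and back from \<open>c\<close> to \<open>d\<close>.\<close>
    have D1: "smooth_linear_on ?O (\<lambda>x. trans_deriv d c (chart_inv d x))"
      by (rule smooth_linear_on_subset[OF smooth_linear_on_trans_deriv[OF d assms(1)]]) (use V in auto)
    have M: "smooth_linear_on ?O (\<lambda>x. M (chart_map c (chart_inv d x)))"
      by (rule smooth_linear_on_compose_transition[OF assms(1) d V smooth_linear_on_subset[OF assms(4) VU] V(1)]) auto
    have "smooth_linear_on ?O (\<lambda>x. trans_deriv c d (chart_inv c (chart_map c (chart_inv d x))))"
      by (rule smooth_linear_on_compose_transition[OF assms(1) d V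
            smooth_linear_on_trans_deriv[OF assms(1) d] openin_chart_dom[OF d]]) auto
    then have "smooth_on ?O (\<lambda>x. trans_deriv c d (chart_inv c (chart_map c (chart_inv d x)))
        (M (chart_map c (chart_inv d x)) (trans_deriv d c (chart_inv d x) i)))"
      by (rule smooth_linear_on_apply[OF _ oO smooth_linear_on_apply[OF M oO smooth_linear_onD(2)[OF D1]]])
    then have "smooth_on ?O (\<lambda>x. f (chart_inv d x) * (trans_deriv c d (chart_inv c (chart_map c (chart_inv d x)))
        (M (chart_map c (chart_inv d x)) (trans_deriv d c (chart_inv d x) i)) \<bullet> j))"
      by (rule smooth_on_mult[OF oO sf[OF d] smooth_on_inner[OF oO _ smooth_on_const]])
    then have "smooth_on ?O (\<lambda>x. ?F (chart_inv d x))"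
      by (rule smooth_on_cong[OF oO, THEN iffD1, rotated])
        (use d assms(1) V in \<open>auto simp: T_def coord_vec_apply\<close>)
    then show "smooth_on (chart_image d) (\<lambda>x. ?F (chart_inv d x))"
      by (rule smooth_on_extend_by_zero[OF d V(1) K KV, rotated]) (simp add: T_def f0)
  qed
  moreover have "openin Z W" unfolding W_def by (rule openin_chart_preimage[OF assms(1) open_ball])
  moreover have "p \<in> W" using assms(5) r by (simp add: W_def)
  moreover have "f q = 1" if "q \<in> W" for q using that g(2) by (simp add: W_def f_def)
  moreover have "f q = 0" if "\<not> (q \<in> chart_dom c \<and> chart_map c q \<in> U)" for q
    using that f0 KV by (auto simp: V_def)
  ultimately show thesis
    using that[of W f T] by (simp add: T_def V_def)
qed

text \<open>Scaling the desired equation by \<open>f q\<close> makes it valid on all of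
  \<open>Z\<close>, including where the cut-off vanishes; this is the form in which local solutions
  can be glued.\<close>

lemma local_recursion_tensor:
  assumes w: "bivector_field Z A w" and w': "bivector_field Z A w'"
    and rank: "\<And>q. q \<in> topspace Z \<Longrightarrow> dim (sharp A w q ` cotangent_space A q) = r"
    and image: "\<And>q. q \<in> topspace Z \<Longrightarrow>
      sharp A w q ` cotangent_space A q = sharp A w' q ` cotangent_space A q"
    and p: "p \<in> topspace Z"
  shows "\<exists>W f T. openin Z W \<and> p \<in> W \<and> (\<forall>q\<in>W. f q = 1) \<and> smooth_function f \<and> tensor11_field Z A T \<and>
    (\<forall>q\<in>topspace Z. \<forall>\<alpha>\<in>cotangent_space A q. T q (sharp A w q \<alpha>) = f q *\<^sub>R sharp A w' q \<alpha>)"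
proof -
  obtain c where c: "c \<in> A" "p \<in> chart_dom c" using chart_cover[OF p] .
  have x: "\<exists>q\<in>chart_dom c. x = chart_map c q \<and> q \<in> topspace Z" if "x \<in> chart_image c" for x
    using that chart_dom_subset[OF c(1)] by blast
  have skew: "comp_map u c x a \<bullet> b = - (comp_map u c x b \<bullet> a)"
    if u: "bivector_field Z A u" and x': "x \<in> chart_image c" for u x a b
  proof -
    obtain q where q: "q \<in> chart_dom c" "x = chart_map c q" "q \<in> topspace Z"
      using x[OF x'] by blast
    note cv = coord_covec_in_cotangent_space[OF c(1) q(1)]
    show ?thesis
      unfolding q(2) comp_map_inner[OF u c(1) q(1)] by (rule bivector_skew[OF u q(3) cv cv])
  qed
  have "dim (range (comp_map w c x)) = r" if "x \<in> chart_image c" for x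
    using x[OF that] dim_sharp_image[OF w c(1)] rank by metis
  moreover have "range (comp_map w' c x) = range (comp_map w c x)" if "x \<in> chart_image c" for x
  proof -
    obtain q where q: "q \<in> chart_dom c" "x = chart_map c q" "q \<in> topspace Z"
      using x[OF \<open>x \<in> chart_image c\<close>] by blast
    show ?thesis
      using image[OF q(3)] unfolding sharp_image[OF w c(1) q(1)] sharp_image[OF w' c(1) q(1)] q(2)
      by (simp only: inj_image_eq_iff[OF inj_coord_vec[OF c(1) q(1)]])
  qed
  ultimately obtain U M where U: "open U" "chart_map c p \<in> U" "U \<subseteq> chart_image c"
    and M: "smooth_linear_on U M" "\<And>x u. x \<in> U \<Longrightarrow> M x (comp_map w c x u) = comp_map w' c x u"
    using local_recursion_operator[OF open_chart_image[OF c(1)] imageI[OF c(2)]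
      smooth_linear_on_comp_map[OF c(1) w] smooth_linear_on_comp_map[OF c(1) w'] skew[OF w] skew[OF w']]
    by metis
  obtain W f T where W: "openin Z W" "p \<in> W" "\<And>q. q \<in> W \<Longrightarrow> f q = 1"
    and f: "smooth_function f" and T: "tensor11_field Z A T"
    and T_eq: "\<And>q v. T q v = (if q \<in> chart_dom c \<and> chart_map c q \<in> U
        then f q *\<^sub>R coord_vec A c (M (chart_map c q) (v c)) q else 0)"
    and f0: "\<And>q. \<not> (q \<in> chart_dom c \<and> chart_map c q \<in> U) \<Longrightarrow> f q = 0"
    by (rule tensor_cutoff[OF c(1) U(1,3) M(1) c(2) U(2)]) (rule that)
  have "T q (sharp A w q \<alpha>) = f q *\<^sub>R sharp A w' q \<alpha>" if \<alpha>: "\<alpha> \<in> cotangent_space A q" for q \<alpha>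
  proof (cases "q \<in> chart_dom c \<and> chart_map c q \<in> U")
    case True
    then have qc: "q \<in> chart_dom c" and qU: "chart_map c q \<in> U" by auto
    obtain a where a: "\<alpha> = coord_covec A c a q"
      using cotangent_eq_coord_covec[OF c(1) qc \<alpha>] .
    show ?thesis
      unfolding a sharp_coord_covec[OF w c(1) qc] sharp_coord_covec[OF w' c(1) qc] T_eq
      using True by (simp add: coord_vec_self[OF c(1) qc] M(2)[OF qU])
  next
    case False
    then show ?thesis by (simp only: T_eq f0[OF False] if_False scaleR_zero_left)
  qed
  then show ?thesis using W f T by blast
qed

text \<open>Second countability gives the Lindelof property. Indexing by all naturals, possibly with
  repetitions, requires a nonempty set of points.\<close>

lemma countable_subcover:
  assumes "topspace Z \<noteq> {}" "\<And>p. p \<in> topspace Z \<Longrightarrow> openin Z (W p) \<and> p \<in> W p"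
  obtains s :: "nat \<Rightarrow> 'a" where "\<And>n. s n \<in> topspace Z" "topspace Z = (\<Union>n. W (s n))"
proof -
  have Lindelof: "Lindelof_space Z"
    using manifold by (auto simp: smooth_manifold_def intro: second_countable_imp_Lindelof_space)
  have cover: "\<Union> (W ` topspace Z) = topspace Z"
  proof
    show "\<Union> (W ` topspace Z) \<subseteq> topspace Z"
      using assms(2) openin_subset by fastforce
    show "topspace Z \<subseteq> \<Union> (W ` topspace Z)"
      using assms(2) by blast
  qed
  have "\<exists>\<V>. countable \<V> \<and> \<V> \<subseteq> W ` topspace Z \<and> \<Union> \<V> = topspace Z"
    by (rule Lindelof_spaceD[OF Lindelof _ cover]) (use assms(2) in auto)
  then obtain \<V> where V: "countable \<V>" "\<V> \<subseteq> W ` topspace Z" "\<Union> \<V> = topspace Z"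
    by (elim exE conjE)
  obtain C where C: "countable C" "C \<subseteq> topspace Z" "\<V> = W ` C"
    using V(1,2) by (meson countable_subset_image)
  then have "C \<noteq> {}" using V(3) assms(1) by (metis Union_empty image_empty)
  then have "range (from_nat_into C) = C" using C(1) by (rule range_from_nat_into)
  show thesis
  proof
    show "from_nat_into C n \<in> topspace Z" for n
      using from_nat_into[OF \<open>C \<noteq> {}\<close>] C(2) by blast
    show "topspace Z = (\<Union>n. W (from_nat_into C n))"
      using V(3) C(3) \<open>range (from_nat_into C) = C\<close> by (metis image_image)
  qed
qed

text \<open>Since \<open>f m = 1\<close> on \<open>W m\<close>, the weights \<open>f n * (\<Prod>m<n. 1 - f m)\<close> with \<open>n > m\<close> vanish on \<open>W m\<close>,
  and the other ones telescope to \<open>1\<close> there. So these weights form a locally finite partition of unity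
  without any refinement of the cover.\<close>

lemma sum_telescoping_weights:
  fixes f :: "nat \<Rightarrow> real"
  shows "(\<Sum>n\<le>N. (\<Prod>m<n. 1 - f m) * f n) = 1 - (\<Prod>m<Suc N. 1 - f m)"
  by (induction N) (simp_all add: algebra_simps)

lemma glue_tensors:
  fixes f :: "nat \<Rightarrow> 'a \<Rightarrow> real"
  assumes W: "\<And>n. openin Z (W n)" "topspace Z = (\<Union>n. W n)" "\<And>n q. q \<in> W n \<Longrightarrow> f n q = 1"
    and f: "\<And>n. smooth_function (f n)"
    and T: "\<And>n. tensor11_field Z A (T n)"
  obtains R where "tensor11_field Z A R"
    "\<And>q v u. q \<in> topspace Z \<Longrightarrow> (\<And>n. T n q v = f n q *\<^sub>R u) \<Longrightarrow> R q v = u"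
proof -
  define g where "g = (\<lambda>n q. \<Prod>m<n. 1 - f m q)"
  \<comment> \<open>The weights of index greater than \<open>N q\<close> vanish at \<open>q\<close>,
    so the sum in \<open>R\<close> can stop there.\<close>
  define N where "N = (\<lambda>q. LEAST n. q \<in> W n)"
  define R where "R = (\<lambda>q v. \<Sum>n\<le>N q. g n q *\<^sub>R T n q v)"
  have g0: "g n q = 0" if "q \<in> W m" "m < n" for n m q
    using that W(3)[OF that(1)] unfolding g_def by (intro prod_zero) auto
  have N: "q \<in> W (N q)" if "q \<in> topspace Z" for q
    using that W(2) unfolding N_def by (metis LeastI_ex UN_E)
  \<comment> \<open>The cut at \<open>N q\<close> varies with the point; raising it to a common
    \<open>m\<close> gives a sum of fixed length on the open set \<open>W m\<close>, as smoothness
    requires.\<close>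
  have R: "R q v = (\<Sum>n\<le>m. g n q *\<^sub>R T n q v)" if "q \<in> W m" for m q v
  proof -
    have "N q \<le> m" unfolding N_def using that by (rule Least_le)
    moreover have "q \<in> W (N q)" using that unfolding N_def by (rule LeastI)
    ultimately show ?thesis
      unfolding R_def using g0 by (intro sum.mono_neutral_left) auto
  qed
  have "tensor11_field Z A R"
    unfolding tensor11_field_def
  proof (intro conjI ballI)
    fix q assume q: "q \<in> topspace Z"
    have Tq: "T n q ` tangent_space A q \<subseteq> tangent_space A q" "linear_on (tangent_space A q) (T n q)" for n
      using T[of n] q by (simp_all add: tensor11_field_def)
    show "R q ` tangent_space A q \<subseteq> tangent_space A q"
      unfolding R_def using Tq(1)
      by (intro image_subsetI subspace_sum subspace_scale subspace_tangent_space[OF q]) blast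
    have add: "T n q (u + v) = T n q u + T n q v"
      if "u \<in> tangent_space A q" "v \<in> tangent_space A q" for n u v
      using Tq(2)[of n] that unfolding linear_on_def by blast
    have scale: "T n q (r *\<^sub>R v) = r *\<^sub>R T n q v" if "v \<in> tangent_space A q" for n r v
      using Tq(2)[of n] that unfolding linear_on_def by blast
    show "linear_on (tangent_space A q) (R q)"
      unfolding linear_on_def R_def
      by (auto simp: add scale scaleR_add_right sum.distrib scaleR_sum_right mult.commute)
  next
    fix d :: "('a, 'e) chart" and i j :: 'e
    assume d: "d \<in> A" and ij: "i \<in> Basis" "j \<in> Basis"
    show "smooth_on (chart_image d) (\<lambda>x. R (chart_inv d x) (coord_vec A d i (chart_inv d x)) d \<bullet> j)"
    proof (rule smooth_on_local)
      fix x assume "x \<in> chart_image d"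
      then obtain q where q: "q \<in> chart_dom d" "x = chart_map d q" by blast
      then obtain m where m: "q \<in> W m" using chart_dom_subset[OF d] W(2) by blast
      let ?O = "chart_map d ` (chart_dom d \<inter> W m)"
      have oO: "open ?O" by (rule open_chart_map_image[OF d W(1)])
      have OU: "?O \<subseteq> chart_image d" by auto
      have "smooth_on ?O (\<lambda>x. f n (chart_inv d x))" for n
        using f[of n] d OU by (auto simp: smooth_function_def simp del: split_paired_All intro: smooth_on_subset)
      then have "smooth_on ?O (\<lambda>x. g n (chart_inv d x))" for n
        unfolding g_def by (intro smooth_intros oO)
      moreover have "smooth_on ?O (\<lambda>x. T n (chart_inv d x) (coord_vec A d i (chart_inv d x)) d \<bullet> j)" for n
        using T[of n] d ij by (intro smooth_on_subset[OF _ OU]) (simp add: tensor11_field_def)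
      ultimately have "smooth_on ?O (\<lambda>x. \<Sum>n\<le>m. g n (chart_inv d x) *
          (T n (chart_inv d x) (coord_vec A d i (chart_inv d x)) d \<bullet> j))"
        by (intro smooth_on_sum smooth_on_mult oO)
      then have "smooth_on ?O (\<lambda>x. R (chart_inv d x) (coord_vec A d i (chart_inv d x)) d \<bullet> j)"
        by (rule smooth_on_cong[OF oO, THEN iffD1, rotated])
          (use d in \<open>auto simp: R sum_fun_apply inner_sum_left\<close>)
      then show "\<exists>U. open U \<and> x \<in> U \<and>
          smooth_on U (\<lambda>x. R (chart_inv d x) (coord_vec A d i (chart_inv d x)) d \<bullet> j)"
        using oO q m by blast
    qed
  qed
  moreover have "R q v = u" if q: "q \<in> topspace Z" and u: "\<And>n. T n q v = f n q *\<^sub>R u" for q v u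
  proof -
    have "R q v = (\<Sum>n\<le>N q. g n q * f n q) *\<^sub>R u"
      unfolding R_def u by (simp add: scaleR_sum_left)
    \<comment> \<open>The factor of index \<open>N q\<close> is 0, so by telescoping the weights sum
      to 1 and the multiples of \<open>u\<close> add up to \<open>u\<close> itself.\<close>
    moreover have "(\<Prod>m<Suc (N q). 1 - f m q) = 0"
      using W(3)[OF N[OF q]] by (intro prod_zero) auto
    ultimately show ?thesis
      unfolding g_def sum_telescoping_weights[of "\<lambda>n. f n q" "N q"] by (simp only: diff_zero scaleR_one)
  qed
  ultimately show thesis by (rule that)
qed

section \<open>Dual endomorphisms and existence of recursion operators\<close>

lemma dual_endo_in_cotangent_space:
  assumes "tensor11_field Z A R" "p \<in> topspace Z" "\<alpha> \<in> cotangent_space A p"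
  shows "dual_endo A R p \<alpha> \<in> cotangent_space A p"
proof -
  have R: "\<And>v. v \<in> tangent_space A p \<Longrightarrow> R p v \<in> tangent_space A p" "linear_on (tangent_space A p) (R p)"
    using assms(1,2) unfolding tensor11_field_def by blast+
  have \<alpha>: "linear_on (tangent_space A p) \<alpha>"
    using assms(3) by (simp add: cotangent_space_def)
  have sub: "subspace (tangent_space A p)" by (rule subspace_tangent_space[OF assms(2)])
  have "linear_on (tangent_space A p) (dual_endo A R p \<alpha>)"
    unfolding linear_on_def
  proof (intro conjI ballI allI)
    fix u v assume uv: "u \<in> tangent_space A p" "v \<in> tangent_space A p"
    have "R p (u + v) = R p u + R p v" using R(2) uv unfolding linear_on_def by blast
    moreover have "\<alpha> (R p u + R p v) = \<alpha> (R p u) + \<alpha> (R p v)"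
      using \<alpha> R(1) uv unfolding linear_on_def by blast
    ultimately show "dual_endo A R p \<alpha> (u + v) = dual_endo A R p \<alpha> u + dual_endo A R p \<alpha> v"
      using uv subspace_add[OF sub uv] by (simp add: dual_endo_def)
  next
    fix r v assume v: "v \<in> tangent_space A p"
    have "R p (r *\<^sub>R v) = r *\<^sub>R R p v" using R(2) v unfolding linear_on_def by blast
    moreover have "\<alpha> (r *\<^sub>R R p v) = r *\<^sub>R \<alpha> (R p v)"
      using \<alpha> R(1)[OF v] unfolding linear_on_def by blast
    ultimately show "dual_endo A R p \<alpha> (r *\<^sub>R v) = r *\<^sub>R dual_endo A R p \<alpha> v"
      using v subspace_scale[OF sub v] by (simp add: dual_endo_def)
  qed
  then show ?thesis by (simp add: cotangent_space_def dual_endo_def)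
qed

text \<open>The second defining equation of a recursion operator follows from the first one by
  skew-symmetry of the bivectors.\<close>

lemma recursion_operatorI:
  assumes w: "bivector_field Z A w" and w': "bivector_field Z A w'" and R: "tensor11_field Z A R"
    and eq: "\<And>p \<alpha>. p \<in> topspace Z \<Longrightarrow> \<alpha> \<in> cotangent_space A p \<Longrightarrow> R p (sharp A w p \<alpha>) = sharp A w' p \<alpha>"
  shows "recursion_operator Z A w w' R"
  unfolding recursion_operator_def
proof (intro conjI R ballI)
  fix p \<alpha> assume p: "p \<in> topspace Z" and \<alpha>: "\<alpha> \<in> cotangent_space A p"
  show "sharp A w' p \<alpha> = R p (sharp A w p \<alpha>)" using eq[OF p \<alpha>] by simp
  have dual: "dual_endo A R p \<alpha> \<in> cotangent_space A p"
    by (rule dual_endo_in_cotangent_space[OF R p \<alpha>])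
  show "sharp A w' p \<alpha> = sharp A w p (dual_endo A R p \<alpha>)"
  proof (rule tangent_eqI[OF p sharp_in_tangent_space[OF w' p \<alpha>] sharp_in_tangent_space[OF w p dual]])
    fix \<beta> assume \<beta>: "\<beta> \<in> cotangent_space A p"
    have "\<beta> (sharp A w p (dual_endo A R p \<alpha>)) = - dual_endo A R p \<alpha> (sharp A w p \<beta>)"
      using bivector_skew[OF w p dual \<beta>] by (simp add: cotangent_sharp w p dual \<beta>)
    also have "\<dots> = - \<alpha> (sharp A w' p \<beta>)"
      using sharp_in_tangent_space[OF w p \<beta>] eq[OF p \<beta>] by (simp add: dual_endo_def)
    also have "\<dots> = \<beta> (sharp A w' p \<alpha>)"
      using bivector_skew[OF w' p \<alpha> \<beta>] by (simp add: cotangent_sharp w' p \<alpha> \<beta>)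
    finally show "\<beta> (sharp A w' p \<alpha>) = \<beta> (sharp A w p (dual_endo A R p \<alpha>))" by simp
  qed
qed

lemma recursion_operator_exists:
  assumes w: "bivector_field Z A w" and w': "bivector_field Z A w'"
    and rank: "\<And>q. q \<in> topspace Z \<Longrightarrow> dim (sharp A w q ` cotangent_space A q) = r"
    and image: "\<And>q. q \<in> topspace Z \<Longrightarrow>
      sharp A w q ` cotangent_space A q = sharp A w' q ` cotangent_space A q"
  shows "\<exists>R. recursion_operator Z A w w' R"
proof (cases "topspace Z = {}")
  \<comment> \<open>The enumeration used for gluing consists of points of \<open>Z\<close>, so the
    empty manifold is treated separately; its chart images are empty and the zero field
    serves.\<close>
  case True
  then have "chart_image c = {}" if "c \<in> A" for c
    using chart_dom_subset[OF that] by simp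
  then have "tensor11_field Z A (\<lambda>p v. 0)"
    unfolding tensor11_field_def using True by (simp add: smooth_on_const)
  then show ?thesis
    using True unfolding recursion_operator_def by blast
next
  case False
  obtain W f T where *: "\<And>p. p \<in> topspace Z \<Longrightarrow> openin Z (W p) \<and> p \<in> W p \<and> (\<forall>q\<in>W p. f p q = 1) \<and>
      smooth_function (f p) \<and> tensor11_field Z A (T p) \<and>
      (\<forall>q\<in>topspace Z. \<forall>\<alpha>\<in>cotangent_space A q. T p q (sharp A w q \<alpha>) = f p q *\<^sub>R sharp A w' q \<alpha>)"
    using local_recursion_tensor[OF w w' rank image] by metis
  obtain s where s: "\<And>n::nat. s n \<in> topspace Z" "topspace Z = (\<Union>n. W (s n))"
    using countable_subcover[OF False, of W] * by metis
  obtain R where R: "tensor11_field Z A R"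
    "\<And>q v u. q \<in> topspace Z \<Longrightarrow> (\<And>n. T (s n) q v = f (s n) q *\<^sub>R u) \<Longrightarrow> R q v = u"
    using glue_tensors[of "\<lambda>n. W (s n)" "\<lambda>n. f (s n)" "\<lambda>n. T (s n)"] * s by metis
  have "R p (sharp A w p \<alpha>) = sharp A w' p \<alpha>" if "p \<in> topspace Z" "\<alpha> \<in> cotangent_space A p" for p \<alpha>
    by (rule R(2)[OF that(1)]) (use * s(1) that in blast)
  then show ?thesis
    using recursion_operatorI[OF w w' R(1)] by blast
qed

end

text \<open>Each pair records its base point, so equality of the total images splits into equality
  of the fibres, to which the pointwise results apply.\<close>

lemma characteristic_distribution_eq_iff:
  "characteristic_distribution Z A w = characteristic_distribution Z A w' \<longleftrightarrow>
    (\<forall>p\<in>topspace Z. sharp A w p ` cotangent_space A p = sharp A w' p ` cotangent_space A p)"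
proof -
  have *: "characteristic_distribution Z A u = (SIGMA p:topspace Z. sharp A u p ` cotangent_space A p)" for u
    by (auto simp: characteristic_distribution_def cotangent_bundle_def)
  have fibre: "sharp A u p ` cotangent_space A p = characteristic_distribution Z A u `` {p}"
    if "p \<in> topspace Z" for u p
    unfolding * using that by auto
  show ?thesis
  proof
    assume "characteristic_distribution Z A w = characteristic_distribution Z A w'"
    then show "\<forall>p\<in>topspace Z. sharp A w p ` cotangent_space A p = sharp A w' p ` cotangent_space A p"
      by (simp add: fibre)
  next
    assume "\<forall>p\<in>topspace Z. sharp A w p ` cotangent_space A p = sharp A w' p ` cotangent_space A p"
    then show "characteristic_distribution Z A w = characteristic_distribution Z A w'"
      unfolding * by (intro Sigma_cong) auto
  qed
qed

theorem theorem1: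
  fixes Z :: "'a topology"
    and A :: "('a, 'e::euclidean_space) chart set"
    and w w' :: "'a \<Rightarrow> ('a, 'e) bivector"
    and k :: nat
  assumes "smooth_manifold Z A"
    and "2 * k \<le> DIM('e)"
    and "regular_poisson Z A w k"
    and "regular_poisson Z A w' k"
  shows "(\<exists>R. recursion_operator Z A w w' R) \<longleftrightarrow>
    characteristic_distribution Z A w = characteristic_distribution Z A w'"
proof -
  interpret smooth_atlas Z A by standard (rule assms(1))
  have w: "bivector_field Z A w" "\<And>p. p \<in> topspace Z \<Longrightarrow> dim (sharp A w p ` cotangent_space A p) = 2 * k"
    using assms(3) by (simp_all add: regular_poisson_def poisson_bivector_def)
  have w': "bivector_field Z A w'" "\<And>p. p \<in> topspace Z \<Longrightarrow> dim (sharp A w' p ` cotangent_space A p) = 2 * k"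
    using assms(4) by (simp_all add: regular_poisson_def poisson_bivector_def)
  show ?thesis
    unfolding characteristic_distribution_eq_iff
  proof
    assume "\<exists>R. recursion_operator Z A w w' R"
    then obtain R where R: "tensor11_field Z A R" "\<And>p \<alpha>. p \<in> topspace Z \<Longrightarrow> \<alpha> \<in> cotangent_space A p \<Longrightarrow>
        sharp A w' p \<alpha> = sharp A w p (dual_endo A R p \<alpha>)"
      unfolding recursion_operator_def by blast
    show "\<forall>p\<in>topspace Z. sharp A w p ` cotangent_space A p = sharp A w' p ` cotangent_space A p"
    proof
      fix p assume p: "p \<in> topspace Z"
      have "sharp A w' p ` cotangent_space A p \<subseteq> sharp A w p ` cotangent_space A p"
        using R(2)[OF p] dual_endo_in_cotangent_space[OF R(1) p] by (intro image_subsetI) simp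
      then show "sharp A w p ` cotangent_space A p = sharp A w' p ` cotangent_space A p"
        using sharp_image_eqI[OF w(1) w'(1) p] w(2)[OF p] w'(2)[OF p] by simp
    qed
  next
    assume "\<forall>p\<in>topspace Z. sharp A w p ` cotangent_space A p = sharp A w' p ` cotangent_space A p"
    then show "\<exists>R. recursion_operator Z A w w' R"
      using recursion_operator_exists[OF w(1) w'(1) w(2)] by blast
  qed
qed

end
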